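(* Let $c = 4+2\sqrt 2 \ge 6.828$. Every complete set of representations for $n$ has $\Omega\bigl(n!\cdot\frac{c^n}{n^4}\bigr)$ elements; that is, there is a constant $K>0$ such that for every integer $n\ge 1$, every complete set of representations for $n$ has at least $K\cdot n!\cdot\frac{c^n}{n^4}$ elements.
   Context: Let $n\ge 1$ be an integer and $[n]=\{1,\ldots,n\}$. A placement of size $n$ is a tuple $P=(x_{\min},y_{\min},x_{\max},y_{\max})$ of functions $[n]\to\mathbb{R}$ with $x_{\min}(i)<x_{\max}(i)$ and $y_{\min}(i)<y_{\max}(i)$ for all $i\in[n]$. For $i\neq j$ in $[n]$ we say (in $P$): $i$ is west of $j$ if $x_{\max}(i)\le x_{\min}(j)$; $i$ is south of $j$ if $y_{\max}(i)\le y_{\min}(j)$; $i$ is east of $j$ if $x_{\max}(j)\le x_{\min}(i)$; $i$ is north of $j$ if $y_{\max}(j)\le y_{\min}(i)$. $P$ is feasible if for all $i\ne j$ at least one of these four spatial relations holds for $(i,j)$. A function $r:[n]^2\setminus\{(i,i):i\in[n]\}\to\{\text{west},\text{south},\text{east},\text{north}\}$ represents (is a representation of) a feasible placement $P$ if for all $i\neq j$ the spatial relation $r(i,j)$ holds for $(i,j)$ in $P$ (e.g. $r(i,j)=\text{west}$ implies $i$ is west of $j$). A complete set of representations for $n$ is a set $R$ of such functions such that for every feasible placement $P$ of size $n$ there is an element of $R$ that represents $P$. *)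

theory Defs
  imports Complex_Main "HOL-Library.FuncSet"
begin

text \<open>
  The coordinate functions are total on \<^typ>\<open>nat\<close>; a placement of size \<open>n\<close> is constrained, and
  looked at, only on the index set \<open>{1..n}\<close>, so its values elsewhere are irrelevant.
\<close>

record placement =
  xmin :: "nat \<Rightarrow> real"
  ymin :: "nat \<Rightarrow> real"
  xmax :: "nat \<Rightarrow> real"
  ymax :: "nat \<Rightarrow> real"

definition is_placement :: "nat \<Rightarrow> placement \<Rightarrow> bool" where
  "is_placement n P \<longleftrightarrow> (\<forall>i\<in>{1..n}. xmin P i < xmax P i \<and> ymin P i < ymax P i)"

datatype direction = West | South | East | North

fun spatial_rel :: "placement \<Rightarrow> direction \<Rightarrow> nat \<Rightarrow> nat \<Rightarrow> bool" where
  "spatial_rel P West i j \<longleftrightarrow> xmax P i \<le> xmin P j"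
| "spatial_rel P South i j \<longleftrightarrow> ymax P i \<le> ymin P j"
| "spatial_rel P East i j \<longleftrightarrow> xmax P j \<le> xmin P i"
| "spatial_rel P North i j \<longleftrightarrow> ymax P j \<le> ymin P i"

definition off_diagonal :: "nat \<Rightarrow> (nat \<times> nat) set" where
  "off_diagonal n = {(i, j). i \<in> {1..n} \<and> j \<in> {1..n} \<and> i \<noteq> j}"

definition feasible :: "nat \<Rightarrow> placement \<Rightarrow> bool" where
  "feasible n P \<longleftrightarrow>
     is_placement n P \<and> (\<forall>(i, j) \<in> off_diagonal n. \<exists>d. spatial_rel P d i j)"

text \<open>
  Functions with domain \<^term>\<open>off_diagonal n\<close> are represented by the extensional function space, so
  that two candidates are equal iff they agree on \<^term>\<open>off_diagonal n\<close>, and cardinalities count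
  functions on that domain. In particular this space is finite.
\<close>

definition representation_functions :: "nat \<Rightarrow> (nat \<times> nat \<Rightarrow> direction) set" where
  "representation_functions n = off_diagonal n \<rightarrow>\<^sub>E UNIV"

definition represents :: "nat \<Rightarrow> (nat \<times> nat \<Rightarrow> direction) \<Rightarrow> placement \<Rightarrow> bool" where
  "represents n r P \<longleftrightarrow> (\<forall>(i, j) \<in> off_diagonal n. spatial_rel P (r (i, j)) i j)"

definition complete_representations :: "nat \<Rightarrow> (nat \<times> nat \<Rightarrow> direction) set \<Rightarrow> bool" where
  "complete_representations n R \<longleftrightarrow>
     R \<subseteq> representation_functions n \<and> (\<forall>P. feasible n P \<longrightarrow> (\<exists>r\<in>R. represents n r P))"

end

(* Attach to a permutation of {1..n} the partial orders "west" (non-inversions) and "south"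
   (inversions). If a placement has, for every covering pair of these two orders, exactly one spatial
   relation, then a representation is forced on the covering pairs; such "rigid" placements with a
   common representation must carry the same two orders, so the number of rigidly realisable
   permutations, times n! labellings, is a lower bound.

   Rigidly realisable permutations are grown by inserting a new maximum at "active" sites. The
   numbers p, q of active sites on the two sides of the maximum, with two flags, form a generating
   tree. In the variables x = 1 + a, y = 1 + 1/b its recursion has eigenfunctions x^p y^q whose
   eigenvalue l satisfies l^2 = s l - s for s = (1+a)(1+b)(1+c), abc = 1; antisymmetrising over the
   permutations of a, b, c kills the boundary terms. Hence the number of nodes at depth m is,
   up to a constant, at least the average over |a| = |b| = 1 of |Vandermonde(a,b,c)|^2 times a
   polynomial in s that grows like l^m. The maximum s = 8 at a = b = c = 1 yields l = 4 + 2 sqrt 2,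
   and the neighbourhood of radius n^(-1/2) of this point contributes n^(-1) n^(-3). Averages are
   taken over N-th roots of unity, which makes everything a finite sum. *)

theory Submission
  imports Defs "HOL-Combinatorics.Permutations"
begin

section \<open>Inserting a new maximum\<close>

text \<open>The third variable comes from the boundary terms. Summing a geometric series over the
  right sites leaves a term free of powers of y, which up to sign survives the exchange of b and c
  with a fixed; summing over the left sites leaves one free of powers of x, which does so for the
  exchange of a and c with b fixed. Both exchanges preserve s and together they generate all
  permutations of a, b, c, so alternating sums remove both terms. The flags are there because a site
  directly beside the old maximum changes sides when the new maximum is inserted beyond it, and p
  and q alone do not tell whether such a site exists. Powers of l are replaced by the divided
  differences of l^m over the two roots. These are polynomials in s, so only Laurent polynomials
  have to be averaged. The kernel carries one Vandermonde factor; the second one appears only at the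
  root p = q = 1 after symmetrising. There the weight can be negative only for s <= 4, where it
  grows no faster than 5^m up to a constant, and 5 < c makes this part negligible.\<close>

definition cover :: "(nat \<Rightarrow> real) \<Rightarrow> nat \<Rightarrow> nat \<Rightarrow> bool" where
  "cover pos j i \<longleftrightarrow> j < i \<and> pos j < pos i \<and> (\<forall>m. j < m \<and> m < i \<longrightarrow> \<not> (pos j < pos m \<and> pos m < pos i))"

text \<open>A permutation is given by the positions \<open>pos i\<close> of its values \<open>i\<close>. A function \<open>g\<close> with \<open>levels n pos g\<close>
  will serve as the lower ends \<open>ymin\<close>; the upper end of \<open>j\<close> is then the least level of an
  element north of \<open>j\<close>. The last two conditions say that \<open>j\<close> and \<open>i\<close> overlap vertically whenever
  \<open>j\<close> is covered by \<open>i\<close> in the west order. By symmetry \<open>x \<mapsto> - pos x\<close> exchanges the two orders.\<close>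

definition levels :: "nat \<Rightarrow> (nat \<Rightarrow> real) \<Rightarrow> (nat \<Rightarrow> real) \<Rightarrow> bool" where
  "levels n pos g \<longleftrightarrow>
     (\<forall>i\<in>{1..n}. \<forall>j\<in>{1..n}. i < j \<and> pos j < pos i \<longrightarrow> g i < g j) \<and>
     (\<forall>i\<in>{1..n}. \<forall>j\<in>{1..n}. \<forall>z\<in>{1..n}.
        cover pos j i \<and> pos z < pos j \<and> j < z \<and> z < i \<longrightarrow> g i < g z) \<and>
     (\<forall>i\<in>{1..n}. \<forall>j\<in>{1..n}. \<forall>z\<in>{1..n}.
        cover pos j i \<and> pos j < pos z \<and> pos z < pos i \<and> i < z \<longrightarrow> g j < g z)"

text \<open>The site immediately before \<open>b\<close>, to the right of the maximum \<open>n\<close>, can receive the next maximum.\<close>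

definition active :: "nat \<Rightarrow> (nat \<Rightarrow> real) \<Rightarrow> nat \<Rightarrow> bool" where
  "active n pos b \<longleftrightarrow> b \<in> {1..n} \<and> pos n < pos b \<and> (\<forall>x\<in>{1..n}. pos b < pos x \<longrightarrow> x < b) \<and>
     (\<exists>a\<in>{1..n}. pos a < pos b \<and> (\<forall>x\<in>{1..n}. pos x < pos b \<longrightarrow> pos x \<le> pos a) \<and>
        (\<forall>x\<in>{1..n}. pos x < pos b \<and> a < x \<longrightarrow> b < x))"

lemma cover_upd:
  assumes "i \<le> n" "j \<le> n"
  shows "cover (pos(Suc n := t)) j i \<longleftrightarrow> cover pos j i"
  using assms unfolding cover_def by (auto simp: fun_upd_def)

text \<open>Either set may be empty; with \<open>U = {}\<close> this supplies levels and positions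
  beyond all others.\<close>

lemma ex_between:
  fixes g :: "'a \<Rightarrow> real"
  assumes "finite L" "finite U" "\<And>x y. x \<in> L \<Longrightarrow> y \<in> U \<Longrightarrow> g x < g y"
  shows "\<exists>s. (\<forall>x\<in>L. g x < s) \<and> (\<forall>y\<in>U. s < g y)"
proof -
  have "\<exists>m. (\<forall>x\<in>L. g x \<le> m) \<and> (\<forall>y\<in>U. m < g y)"
  proof (cases "L = {}")
    case True
    have "\<exists>m. \<forall>y\<in>U. m < g y"
      using \<open>finite U\<close>
    proof (induction U)
      case (insert y U)
      then obtain m where "\<forall>z\<in>U. m < g z" by auto
      then show ?case by (intro exI[of _ "min m (g y - 1)"]) auto
    qed auto
    then show ?thesis using True by auto
  next
    case False
    then show ?thesis using assms by (intro exI[of _ "Max (g ` L)"]) auto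
  qed
  then obtain m where m: "\<forall>x\<in>L. g x \<le> m" "\<forall>y\<in>U. m < g y" by auto
  have "\<exists>e>m. \<forall>y\<in>U. e < g y"
    using \<open>finite U\<close> m(2)
  proof (induction U)
    case empty
    show ?case by (auto intro: gt_ex)
  next
    case (insert y U)
    then obtain e where e: "e > m" "\<forall>z\<in>U. e < g z" by auto
    then show ?case using insert.prems by (intro exI[of _ "min e ((m + g y)/2)"]) (auto simp: min_less_iff_disj)
  qed
  then show ?thesis using m by (meson le_less_trans)
qed

text \<open>The level of the new maximum is squeezed between the elements below it, together with the
  lower covers of these, and the elements that have to stay clear of its own lower covers.\<close>

lemma levels_insert_below:
  assumes g: "levels n pos g" and n: "n \<ge> 1" and nt: "pos n < t"
    and site: "(\<forall>x\<in>{1..n}. pos x < t) \<or>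
      (\<exists>b. active n pos b \<and> t < pos b \<and> (\<forall>x\<in>{1..n}. pos x < pos b \<longrightarrow> pos x < t))"
    and t: "t \<notin> pos ` {1..n}" and inj: "inj_on pos {1..n}"
  shows "\<exists>s. levels (Suc n) (pos(Suc n := t)) (g(Suc n := s))"
proof -
  define L where "L = {x\<in>{1..n}. pos x < t}"
  define V where "V = {x\<in>{1..n}. t < pos x}"
  \<comment> \<open>The clauses of \<open>levels\<close> that mention \<open>Suc n\<close>:
    \<open>V\<close> comes from the first, its lower covers from the third with the maximum as
    \<open>z\<close>, and \<open>Up\<close> from the second with the maximum as
    \<open>i\<close>.\<close>
  define Lo where "Lo = V \<union> {j\<in>L. \<exists>i\<in>V. cover pos j i}"
  define Up where "Up = {z\<in>L. \<exists>j\<in>L. j < z \<and> pos z < pos j \<and> (\<forall>m\<in>L. pos j < pos m \<longrightarrow> m < j)}"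
  have fin: "finite Lo" "finite Up" unfolding Lo_def Up_def L_def V_def by auto
  have G1: "\<And>i j. i \<in> {1..n} \<Longrightarrow> j \<in> {1..n} \<Longrightarrow> i < j \<Longrightarrow> pos j < pos i \<Longrightarrow> g i < g j"
    and G2: "\<And>i j z. i \<in> {1..n} \<Longrightarrow> j \<in> {1..n} \<Longrightarrow> z \<in> {1..n} \<Longrightarrow> cover pos j i \<Longrightarrow> pos z < pos j
       \<Longrightarrow> j < z \<Longrightarrow> z < i \<Longrightarrow> g i < g z"
    and G3: "\<And>i j z. i \<in> {1..n} \<Longrightarrow> j \<in> {1..n} \<Longrightarrow> z \<in> {1..n} \<Longrightarrow> cover pos j i \<Longrightarrow> pos j < pos z
       \<Longrightarrow> pos z < pos i \<Longrightarrow> i < z \<Longrightarrow> g j < g z"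
    using g unfolding levels_def by blast+
  have pinj: "x = y" if "pos x = pos y" "x \<in> {1..n}" "y \<in> {1..n}" for x y
    using inj that by (meson inj_onD)
  have LVn: "L \<subseteq> {1..n}" "V \<subseteq> {1..n}" unfolding L_def V_def by auto
  have "g l < g z" if l: "l \<in> Lo" and z: "z \<in> Up" for l z
  proof -
    obtain v where v: "v \<in> V" using l unfolding Lo_def by auto
    then obtain b where b: "active n pos b" "t < pos b" "\<forall>x\<in>{1..n}. pos x < pos b \<longrightarrow> pos x < t"
      using site unfolding V_def by force
    obtain a where a: "a \<in> {1..n}" "pos a < pos b" "\<forall>x\<in>{1..n}. pos x < pos b \<longrightarrow> pos x \<le> pos a"
        "\<forall>x\<in>{1..n}. pos x < pos b \<and> a < x \<longrightarrow> b < x"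
      using b(1) unfolding active_def by blast
    have aL: "a \<in> L" using a b unfolding L_def by auto
    obtain j where j: "j \<in> L" "j < z" "pos z < pos j" "\<forall>m\<in>L. pos j < pos m \<longrightarrow> m < j"
      using z unfolding Up_def by blast
    have bn: "b \<in> {1..n}" using b(1) unfolding active_def by auto
    have zL: "z \<in> L" using z unfolding Up_def by auto
    \<comment> \<open>\<open>a\<close> is the rightmost element of \<open>L\<close>, and nothing in
      \<open>L\<close> to the right of \<open>j\<close> exceeds \<open>j\<close>. Activity of
      \<open>b\<close> then lifts \<open>z\<close> above \<open>b\<close>, hence above all of
      \<open>V\<close>.\<close>
    have "a \<le> j"
    proof (cases "a = j")
      case False
      then have "pos a \<noteq> pos j" using pinj[of a j] a(1) LVn j(1) by blast
      moreover have "pos j \<le> pos a" using a(3) j(1) b unfolding L_def by auto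
      ultimately show ?thesis using j(4) aL by fastforce
    qed simp
    then have zb: "b < z" using a(4) zL j(2) b(2) unfolding L_def by auto
    have vb: "r \<le> b" if "r \<in> V" for r
    proof -
      have "pos b \<le> pos r" using b(3) that unfolding V_def by force
      moreover have "r \<in> {1..n}" using that LVn(2) by blast
      ultimately have "pos b < pos r \<or> b = r" using pinj[of b r] bn by force
      then show ?thesis using b(1) that unfolding active_def V_def by auto
    qed
    have sz: "g r < g z" if "r \<in> V" for r
      using G1[of r z] that vb[OF that] zb zL unfolding L_def V_def by auto
    show ?thesis
    proof (cases "l \<in> V")
      case True then show ?thesis using sz by auto
    next
      case False
      then obtain i where i: "i \<in> V" "cover pos l i" and lL: "l \<in> L" using l unfolding Lo_def by auto
      have iz: "i < z" using vb[OF i(1)] zb by auto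
      have li: "l < i" using i(2) unfolding cover_def by auto
      consider "pos z < pos l" | "pos l < pos z" 
        using pinj[of l z] lL zL li iz LVn(1) by force
      then show ?thesis
      proof cases
        case 1 then show ?thesis using G1[of l z] lL zL li iz unfolding L_def by auto
      next
        case 2 then show ?thesis using G3[of i l z] i iz lL zL unfolding L_def V_def by auto
      qed
    qed
  qed
  then obtain s where s: "\<forall>x\<in>Lo. g x < s" "\<forall>y\<in>Up. s < g y"
    using ex_between[OF fin, of g] by blast
  let ?p = "pos(Suc n := t)" and ?g = "g(Suc n := s)"
  have cE: "cover ?p j i = cover pos j i" if "i \<in> {1..n}" "j \<in> {1..n}" for i j
    using cover_upd that by auto
  have c2: "j \<in> L" "\<forall>m\<in>L. pos j < pos m \<longrightarrow> m < j" if "j \<in> {1..n}" "cover ?p j (Suc n)" for j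
  proof -
    show jL: "j \<in> L" using that unfolding L_def cover_def by auto
    show "\<forall>m\<in>L. pos j < pos m \<longrightarrow> m < j"
    proof (intro ballI impI)
      fix m assume m: "m \<in> L" "pos j < pos m"
      have "\<not> (j < m)" using that m unfolding cover_def L_def by (auto dest!: spec[of _ m])
      then show "m < j" using m by (cases "m = j") auto
    qed
  qed
  have "levels (Suc n) ?p ?g"
    unfolding levels_def
  proof (intro conjI ballI impI)
    fix i j assume ij: "i \<in> {1..Suc n}" "j \<in> {1..Suc n}" and "i < j \<and> ?p j < ?p i"
    then show "?g i < ?g j"
      using G1[of i j] s(1) by (cases "j = Suc n") (auto simp: Lo_def V_def)
  next
    fix i j z assume m: "i \<in> {1..Suc n}" "j \<in> {1..Suc n}" "z \<in> {1..Suc n}"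
      and c: "cover ?p j i \<and> ?p z < ?p j \<and> j < z \<and> z < i"
    have j: "j \<in> {1..n}" and z: "z \<in> {1..n}" using c m by auto
    show "?g i < ?g z"
    proof (cases "i = Suc n")
      case False
      then show ?thesis using G2[of i j z] c j z m cE[of i j] by auto
    next
      case True
      have jL: "j \<in> L" "\<forall>m\<in>L. pos j < pos m \<longrightarrow> m < j" using c2[of j] j c True by auto
      moreover have "pos z < pos j" "j < z" using c j z by auto
      moreover have "z \<in> L" using z \<open>pos z < pos j\<close> jL(1) unfolding L_def by auto
      ultimately have "z \<in> Up" unfolding Up_def by blast
      then show ?thesis using s(2) True z by auto
    qed
  next
    fix i j z assume m: "i \<in> {1..Suc n}" "j \<in> {1..Suc n}" "z \<in> {1..Suc n}"
      and c: "cover ?p j i \<and> ?p j < ?p z \<and> ?p z < ?p i \<and> i < z"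
    have i: "i \<in> {1..n}" using c m by auto
    have j: "j \<in> {1..n}" using c m i unfolding cover_def by auto
    show "?g j < ?g z"
    proof (cases "z = Suc n")
      case False
      then show ?thesis using G3[of i j z] c i j m cE[of i j] by auto
    next
      case True
      have "i \<in> V" "j \<in> L" using c i j True unfolding V_def L_def by auto
      then have "j \<in> Lo" unfolding Lo_def using c i j cE[of i j] by auto
      then show ?thesis using s(1) True j by auto
    qed
  qed
  then show ?thesis by blast
qed

text \<open>A top level could only violate the second clause, which asks for some \<open>z\<close>
  above the new maximum. No such \<open>z\<close> exists: it would lie to the right of a south cover
  \<open>j\<close> with \<open>j < z < b\<close>, and then \<open>b\<close> would lie between
  \<open>j\<close> and the maximum in the south order.\<close>

lemma levels_insert_top:
  assumes f: "levels n (\<lambda>x. - pos x) f" and nt: "pos n < t"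
    and site: "(\<forall>x\<in>{1..n}. pos x < t) \<or>
      (\<exists>b. active n pos b \<and> t < pos b \<and> (\<forall>x\<in>{1..n}. pos x < pos b \<longrightarrow> pos x < t))"
    and inj: "inj_on pos {1..n}" and top: "\<And>x. x \<in> {1..n} \<Longrightarrow> f x < s"
  shows "levels (Suc n) (\<lambda>x. - (pos(Suc n := t)) x) (f(Suc n := s))"
proof -
  let ?p = "(\<lambda>x. - (pos(Suc n := t)) x)" and ?f = "f(Suc n := s)"
  let ?q = "(\<lambda>x. - pos x)"
  have pq: "?p = ?q(Suc n := - t)" by auto
  have G1: "\<And>i j. i \<in> {1..n} \<Longrightarrow> j \<in> {1..n} \<Longrightarrow> i < j \<Longrightarrow> ?q j < ?q i \<Longrightarrow> f i < f j"
    and G2: "\<And>i j z. i \<in> {1..n} \<Longrightarrow> j \<in> {1..n} \<Longrightarrow> z \<in> {1..n} \<Longrightarrow> cover ?q j i \<Longrightarrow> ?q z < ?q j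
       \<Longrightarrow> j < z \<Longrightarrow> z < i \<Longrightarrow> f i < f z"
    and G3: "\<And>i j z. i \<in> {1..n} \<Longrightarrow> j \<in> {1..n} \<Longrightarrow> z \<in> {1..n} \<Longrightarrow> cover ?q j i \<Longrightarrow> ?q j < ?q z
       \<Longrightarrow> ?q z < ?q i \<Longrightarrow> i < z \<Longrightarrow> f j < f z"
    using f unfolding levels_def by blast+
  have cE: "cover ?p j i = cover ?q j i" if "i \<in> {1..n}" "j \<in> {1..n}" for i j
    unfolding pq using cover_upd that by auto
  show ?thesis
    unfolding levels_def
  proof (intro conjI ballI impI)
    fix i j assume ij: "i \<in> {1..Suc n}" "j \<in> {1..Suc n}" and "i < j \<and> ?p j < ?p i"
    then show "?f i < ?f j"
      using G1[of i j] top by (cases "j = Suc n") auto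
  next
    fix i j z assume m: "i \<in> {1..Suc n}" "j \<in> {1..Suc n}" "z \<in> {1..Suc n}"
      and c: "cover ?p j i \<and> ?p z < ?p j \<and> j < z \<and> z < i"
    have j: "j \<in> {1..n}" and z: "z \<in> {1..n}" using c m by auto
    show "?f i < ?f z"
    proof (cases "i = Suc n")
      case False
      then show ?thesis using G2[of i j z] c j z m cE[of i j] by auto
    next
      case True
      have tj: "t < pos j" using c j True unfolding cover_def by auto
      then obtain b where b: "active n pos b" "t < pos b" "\<forall>x\<in>{1..n}. pos x < pos b \<longrightarrow> pos x < t"
        using site j by force
      have bn: "b \<in> {1..n}" and bm: "\<forall>x\<in>{1..n}. pos b < pos x \<longrightarrow> x < b"
        using b(1) unfolding active_def by auto
      have "pos b \<le> pos j" using b(3) tj j by force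
      moreover have "pos j < pos z" using c j z by auto
      ultimately have "z < b" using bm z by auto
      then have jb: "j < b" using c by auto
      have "\<not> (pos b < pos j)"
        using c True jb bn b(2) j unfolding cover_def by (auto dest!: spec[of _ b])
      then have "b = j" using \<open>pos b \<le> pos j\<close> inj_onD[OF inj, of b j] bn j by force
      then show ?thesis using jb by simp
    qed
  next
    fix i j z assume m: "i \<in> {1..Suc n}" "j \<in> {1..Suc n}" "z \<in> {1..Suc n}"
      and c: "cover ?p j i \<and> ?p j < ?p z \<and> ?p z < ?p i \<and> i < z"
    have i: "i \<in> {1..n}" using c m by auto
    have j: "j \<in> {1..n}" using c m i unfolding cover_def by auto
    show "?f j < ?f z"
    proof (cases "z = Suc n")
      case False
      then show ?thesis using G3[of i j z] c i j m cE[of i j] by auto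
    next
      case True
      then show ?thesis using top j by auto
    qed
  qed
qed

text \<open>The sites after the elements of \<open>A\<close> and before those of \<open>B\<close> are active, in addition to the
  two ends. The flags state that the sites directly before and directly after the maximum \<open>n\<close> are
  among them.\<close>

definition tree_state ::
  "nat \<Rightarrow> (nat \<Rightarrow> real) \<Rightarrow> (nat \<Rightarrow> real) \<Rightarrow> (nat \<Rightarrow> real) \<Rightarrow> nat set \<Rightarrow> nat set \<Rightarrow> bool \<Rightarrow> bool \<Rightarrow> bool" where
  "tree_state n pos f g A B l r \<longleftrightarrow> n \<ge> 1 \<and> inj_on pos {1..n} \<and>
     levels n pos g \<and> levels n (\<lambda>x. - pos x) f \<and>
     (\<forall>b\<in>B. active n pos b) \<and> (\<forall>a\<in>A. active n (\<lambda>x. - pos x) a) \<and>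
     (r \<longrightarrow> (\<forall>x\<in>{1..n}. pos n < pos x \<longrightarrow> (\<exists>b\<in>B. pos b \<le> pos x))) \<and>
     (l \<longrightarrow> (\<forall>x\<in>{1..n}. pos x < pos n \<longrightarrow> (\<exists>a\<in>A. pos x \<le> pos a)))"

lemma tree_state_mirror:
  "tree_state n pos f g A B l r \<Longrightarrow> tree_state n (\<lambda>x. - pos x) g f B A r l"
  unfolding tree_state_def inj_on_def minus_minus neg_less_iff_less neg_le_iff_le neg_equal_iff_equal
  by blast

lemma active_in: "active n pos b \<Longrightarrow> b \<in> {1..n}"
  unfolding active_def by blast

lemma tree_state_subset: "tree_state n pos f g A B l r \<Longrightarrow> A \<subseteq> {1..n} \<and> B \<subseteq> {1..n}"
  unfolding tree_state_def using active_in by blast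

section \<open>Effect of one insertion on the active sites\<close>

lemma ex_upper_part:
  fixes h :: "'a \<Rightarrow> real"
  assumes "finite B" "inj_on h B" "k \<le> card B"
  shows "\<exists>T\<subseteq>B. card T = k \<and> (\<forall>x\<in>T. \<forall>y\<in>B - T. h y < h x)"
  using assms(3)
proof (induction k)
  case 0
  show ?case by (intro exI[of _ "{}"]) auto
next
  case (Suc k)
  then obtain T where T: "T \<subseteq> B" "card T = k" "\<forall>x\<in>T. \<forall>y\<in>B - T. h y < h x" by auto
  have fT: "finite T" using T(1) assms(1) finite_subset by blast
  have "B - T \<noteq> {}" using T Suc.prems by (metis Diff_eq_empty_iff Suc_n_not_le_n subset_antisym)
  then have "Max (h ` (B - T)) \<in> h ` (B - T)" using assms(1) by (intro Max_in) auto
  then obtain m where m: "m \<in> B - T" "h m = Max (h ` (B - T))" by (metis imageE)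
  have "h y < h m" if "y \<in> B - insert m T" for y
  proof -
    have "h y \<le> h m" using m(2) that assms(1) by auto
    moreover have "h y \<noteq> h m" using assms(2) that m(1) by (metis DiffD1 DiffD2 inj_onD insertI1)
    ultimately show ?thesis by simp
  qed
  then show ?case using T m(1) fT
    by (intro exI[of _ "insert m T"]) auto
qed

text \<open>The insertion takes place directly before the leftmost of the \<open>j - 1\<close>
  surviving sites, or at the far end if \<open>j = 1\<close>. Sites passed over are lost, except
  that the one directly after the old maximum becomes a left site if it was active, which is what
  \<open>r\<close> records.\<close>

lemma right_child:
  assumes st: "tree_state n pos f g A B l r" and j: "j \<in> {1..card B + 1}"
  shows "\<exists>t s s' A'. pos n < t \<and> card A' = card A + of_bool r \<and> card {b\<in>B. t < pos b} = j - 1 \<and>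
    tree_state (Suc n) (pos(Suc n := t)) (f(Suc n := s)) (g(Suc n := s')) A' {b\<in>B. t < pos b}
      (r \<and> j = card B + 1) True"
proof -
  have n: "n \<ge> 1" and inj: "inj_on pos {1..n}" and lg: "levels n pos g"
    and lf: "levels n (\<lambda>x. - pos x) f" and aB: "\<And>b. b \<in> B \<Longrightarrow> active n pos b"
    and aA: "\<And>a. a \<in> A \<Longrightarrow> active n (\<lambda>x. - pos x) a"
    and flag: "r \<Longrightarrow> (\<forall>x\<in>{1..n}. pos n < pos x \<longrightarrow> (\<exists>b\<in>B. pos b \<le> pos x))"
    using st unfolding tree_state_def by blast+
  have sub: "A \<subseteq> {1..n}" "B \<subseteq> {1..n}" using tree_state_subset[OF st] by auto
  have fin: "finite A" "finite B" using sub finite_subset by blast+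
  have pinj: "x = y" if "pos x = pos y" "x \<in> {1..n}" "y \<in> {1..n}" for x y
    using inj that by (meson inj_onD)
  have "inj_on pos B" using inj sub inj_on_subset by blast
  moreover have "j - 1 \<le> card B" using j by auto
  ultimately obtain T where T: "T \<subseteq> B" "card T = j - 1" "\<forall>x\<in>T. \<forall>y\<in>B - T. pos y < pos x"
    using ex_upper_part[OF fin(2), of pos "j - 1"] by blast
  have "\<exists>t. (\<forall>x\<in>{1..n}. pos x \<noteq> t) \<and> pos n < t \<and> T = {b\<in>B. t < pos b} \<and>
     (\<forall>x\<in>{1..n}. t < pos x \<longrightarrow> (\<exists>b\<in>T. pos b \<le> pos x)) \<and>
     ((\<forall>x\<in>{1..n}. pos x < t) \<or>
      (\<exists>b. active n pos b \<and> t < pos b \<and> (\<forall>x\<in>{1..n}. pos x < pos b \<longrightarrow> pos x < t)))"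
  proof (cases "T = {}")
    case True
    obtain t where t: "\<forall>x\<in>{1..n}. pos x < t" using ex_between[of "{1..n}" "{}" pos] by auto
    then show ?thesis using n True sub(2) by (intro exI[of _ t]) force
  next
    case False
    have fT: "finite T" using T(1) fin finite_subset by blast
    then have "Min (pos ` T) \<in> pos ` T" using False by (intro Min_in) auto
    then obtain b where b: "b \<in> T" "pos b = Min (pos ` T)" by (metis imageE)
    then have bm: "\<And>x. x \<in> T \<Longrightarrow> pos b \<le> pos x" using fT by auto
    have ab: "active n pos b" using b(1) T(1) aB by blast
    have "\<exists>t. (\<forall>x\<in>{x\<in>{1..n}. pos x < pos b}. pos x < t) \<and>
        (\<forall>x\<in>{x\<in>{1..n}. pos b \<le> pos x}. t < pos x)"
      by (rule ex_between) auto
    then obtain t where t: "\<forall>x\<in>{x\<in>{1..n}. pos x < pos b}. pos x < t"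
        "\<forall>x\<in>{x\<in>{1..n}. pos b \<le> pos x}. t < pos x" by blast
    have "t < pos b" using t(2) sub(2) T(1) b(1) by auto
    moreover have "pos n < t" using t(1) ab n unfolding active_def by auto
    moreover have "pos x \<noteq> t" if "x \<in> {1..n}" for x using t that by (cases "pos x < pos b") force+
    moreover have "pos b \<le> pos x" if "x \<in> {1..n}" "t < pos x" for x using t that by force
    moreover have "T = {b\<in>B. t < pos b}"
    proof (intro equalityI subsetI)
      fix x assume "x \<in> T" then show "x \<in> {b\<in>B. t < pos b}" using bm \<open>t < pos b\<close> T(1) by force
    next
      fix x assume x: "x \<in> {b\<in>B. t < pos b}"
      then have "\<not> pos x < pos b" using t(1) sub(2) by force
      then show "x \<in> T" using T(3) b(1) x by blast
    qed
    ultimately show ?thesis using ab b(1) t(1) by (intro exI[of _ t]) blast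
  qed
  then obtain t where t: "\<And>x. x \<in> {1..n} \<Longrightarrow> pos x \<noteq> t" "pos n < t" "T = {b\<in>B. t < pos b}"
     "\<And>x. x \<in> {1..n} \<Longrightarrow> t < pos x \<Longrightarrow> (\<exists>b\<in>T. pos b \<le> pos x)"
    and site: "(\<forall>x\<in>{1..n}. pos x < t) \<or>
      (\<exists>b. active n pos b \<and> t < pos b \<and> (\<forall>x\<in>{1..n}. pos x < pos b \<longrightarrow> pos x < t))"
    by blast
  have "t \<notin> pos ` {1..n}" using t(1) by force
  then obtain s' where s': "levels (Suc n) (pos(Suc n := t)) (g(Suc n := s'))"
    using levels_insert_below[OF lg n t(2) site _ inj] by blast
  obtain s where "\<forall>x\<in>{1..n}. f x < s" using ex_between[of "{1..n}" "{}" f] by auto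
  then have s: "levels (Suc n) (\<lambda>x. - (pos(Suc n := t)) x) (f(Suc n := s))"
    using levels_insert_top[OF lf t(2) site inj] by blast
  \<comment> \<open>On the left a site is named by the element before it, so the site directly after
    the old maximum is named \<open>n\<close>.\<close>
  define A' where "A' = (if r then insert n A else A)"
  have "n \<notin> A" using aA unfolding active_def by fastforce
  then have cA: "card A' = card A + of_bool r" using fin unfolding A'_def by auto
  let ?p = "pos(Suc n := t)"
  have pS: "?p (Suc n) = t" and pO: "\<And>x. x \<in> {1..n} \<Longrightarrow> ?p x = pos x" by auto
  have eq: "{1..Suc n} = insert (Suc n) {1..n}" by auto
  have ball: "(\<forall>x\<in>{1..Suc n}. P x) \<longleftrightarrow> P (Suc n) \<and> (\<forall>x\<in>{1..n}. P x)"
    and bex: "(\<exists>x\<in>{1..Suc n}. P x) \<longleftrightarrow> P (Suc n) \<or> (\<exists>x\<in>{1..n}. P x)" for P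
    unfolding eq by auto
  have "inj_on ?p {1..Suc n}"
  proof (rule inj_onI)
    fix x y assume xy: "x \<in> {1..Suc n}" "y \<in> {1..Suc n}" "?p x = ?p y"
    then have "x = Suc n \<or> x \<in> {1..n}" "y = Suc n \<or> y \<in> {1..n}" by auto
    then show "x = y" using t(1)[of x] t(1)[of y] pinj[of x y] pO[of x] pO[of y] pS xy(3) by metis
  qed
  moreover have "active (Suc n) ?p b" if b: "b \<in> T" for b
  proof -
    have "active n pos b" and tb: "t < pos b" using b T(1) aB t(3) by auto
    then obtain a where bn: "b \<in> {1..n}" and bm: "\<forall>x\<in>{1..n}. pos b < pos x \<longrightarrow> x < b"
      and a: "a\<in>{1..n}" "pos a < pos b" "(\<forall>x\<in>{1..n}. pos x < pos b \<longrightarrow> pos x \<le> pos a)"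
        "(\<forall>x\<in>{1..n}. pos x < pos b \<and> a < x \<longrightarrow> b < x)"
      unfolding active_def by blast
    have "\<exists>a\<in>{1..Suc n}. ?p a < ?p b \<and> (\<forall>x\<in>{1..Suc n}. ?p x < ?p b \<longrightarrow> ?p x \<le> ?p a) \<and>
        (\<forall>x\<in>{1..Suc n}. ?p x < ?p b \<and> a < x \<longrightarrow> b < x)"
    \<comment> \<open>A new maximum landing between \<open>a\<close> and \<open>b\<close> becomes
      the left neighbour of \<open>b\<close>, and nothing exceeds it.\<close>
    proof (cases "pos a < t")
      case True
      show ?thesis unfolding bex ball using True a bn tb by (intro disjI1) force
    next
      case False
      then show ?thesis unfolding bex ball using a bn tb by (intro disjI2 bexI[of _ a]) auto
    qed
    moreover have "\<forall>x\<in>{1..Suc n}. ?p b < ?p x \<longrightarrow> x < b"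
      unfolding ball using bm bn tb by auto
    ultimately show ?thesis unfolding active_def using bn tb by auto
  qed
  moreover have "active (Suc n) (\<lambda>x. - ?p x) a" if "a \<in> A'" for a
  proof -
    have 0: "a \<in> {1..n} \<and> pos a \<le> pos n \<and> (\<forall>x\<in>{1..n}. pos x < pos a \<longrightarrow> x < a) \<and>
      (\<exists>c\<in>{1..Suc n}. ?p a < ?p c \<and> (\<forall>x\<in>{1..Suc n}. ?p a < ?p x \<longrightarrow> ?p c \<le> ?p x) \<and>
        (\<forall>x\<in>{1..Suc n}. ?p a < ?p x \<and> c < x \<longrightarrow> a < x))"
    proof (cases "a \<in> A")
      case True
      then obtain c where an: "a \<in> {1..n}" "pos a < pos n" and am: "\<forall>x\<in>{1..n}. pos x < pos a \<longrightarrow> x < a"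
        and c: "c\<in>{1..n}" "pos a < pos c" "(\<forall>x\<in>{1..n}. pos a < pos x \<longrightarrow> pos c \<le> pos x)"
        "(\<forall>x\<in>{1..n}. pos a < pos x \<and> c < x \<longrightarrow> a < x)"
        using aA[of a] unfolding active_def by auto
      have "pos c \<le> pos n" using c(3) an n by auto
      then have "\<exists>c\<in>{1..Suc n}. ?p a < ?p c \<and> (\<forall>x\<in>{1..Suc n}. ?p a < ?p x \<longrightarrow> ?p c \<le> ?p x) \<and>
        (\<forall>x\<in>{1..Suc n}. ?p a < ?p x \<and> c < x \<longrightarrow> a < x)"
        unfolding bex ball using c an t(2) by (intro disjI2 bexI[of _ c]) auto
      then show ?thesis using an am by auto
    next
      case False
      then have an: "a = n" and r using that unfolding A'_def by (auto split: if_splits)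
      have "\<exists>c\<in>{1..Suc n}. ?p n < ?p c \<and> (\<forall>x\<in>{1..Suc n}. ?p n < ?p x \<longrightarrow> ?p c \<le> ?p x) \<and>
        (\<forall>x\<in>{1..Suc n}. ?p n < ?p x \<and> c < x \<longrightarrow> n < x)"
      \<comment> \<open>The right neighbour of \<open>n\<close> is either the leftmost element of
        \<open>B\<close>, which exceeds all old elements to its right, or the new maximum.\<close>
      proof (cases "\<exists>x\<in>{1..n}. pos n < pos x \<and> pos x < t")
        case True
        then obtain x where x: "x \<in> {1..n}" "pos n < pos x" "pos x < t" by blast
        have fx: "\<forall>x\<in>{1..n}. pos n < pos x \<longrightarrow> (\<exists>b\<in>B. pos b \<le> pos x)" using flag \<open>r\<close> by blast
        then have "B \<noteq> {}" using x by blast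
        then have "Min (pos ` B) \<in> pos ` B" using fin by (intro Min_in) auto
        then obtain c where c: "c \<in> B" "pos c = Min (pos ` B)" by (metis imageE)
        then have cm: "\<And>x. x \<in> B \<Longrightarrow> pos c \<le> pos x" using fin by auto
        have cr: "pos c \<le> pos y" if "y \<in> {1..n}" "pos n < pos y" for y using fx that cm by force
        have ac: "c \<in> {1..n}" "pos n < pos c" "\<forall>x\<in>{1..n}. pos c < pos x \<longrightarrow> x < c"
          using aB[OF c(1)] unfolding active_def by auto
        have "pos c < t" using cr[OF x(1,2)] x(3) by simp
        moreover have "\<not> c < y" if "y \<in> {1..n}" "pos n < pos y" for y
        proof (cases "pos c = pos y")
          case True then show ?thesis using pinj[of c y] ac(1) that(1) by simp
        next
          case False then show ?thesis using cr[OF that] ac(3) that(1) by fastforce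
        qed
        ultimately show ?thesis unfolding bex ball using ac cr n
          by (intro disjI2 bexI[of _ c]) auto
      next
        case False
        then show ?thesis unfolding bex ball using t(1,2) n by (intro disjI1) force
      qed
      moreover have "x < n" if "x \<in> {1..n}" "pos x < pos n" for x using that by (cases "x = n") auto
      ultimately show ?thesis using an n by auto
    qed
    then have an: "a \<in> {1..n}" and pa: "?p a = pos a" by auto
    have "\<forall>x\<in>{1..Suc n}. ?p x < ?p a \<longrightarrow> x < a" unfolding ball pa using 0 t(2) by auto
    moreover have "?p a < ?p (Suc n)" unfolding pa pS using 0 t(2) by linarith
    moreover have "a \<in> {1..Suc n}" using an by simp
    ultimately show ?thesis unfolding active_def neg_less_iff_less neg_le_iff_le using 0 by blast
  qed
  moreover have "\<forall>x\<in>{1..Suc n}. ?p (Suc n) < ?p x \<longrightarrow> (\<exists>b\<in>T. ?p b \<le> ?p x)"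
  proof -
    have "?p b = pos b" if "b \<in> T" for b using that sub(2) T(1) pO by blast
    then show ?thesis unfolding ball using t(4) by auto
  qed
  moreover have "\<forall>x\<in>{1..Suc n}. ?p x < ?p (Suc n) \<longrightarrow> (\<exists>a\<in>A'. ?p x \<le> ?p a)"
    if "r \<and> j = card B + 1"
  proof -
    \<comment> \<open>All right sites survive, so by \<open>r\<close> the insertion is directly
      after the old maximum.\<close>
    have TB: "T = B" using T(1,2) that fin card_subset_eq[of B T] by auto
    have "pos x \<le> pos n" if x: "x \<in> {1..n}" "pos x < t" for x
    proof (rule ccontr)
      assume "\<not> pos x \<le> pos n"
      then obtain b where "b \<in> B" "pos b \<le> pos x" using flag \<open>r \<and> _\<close> x(1) by force
      moreover have "t < pos b" using TB t(3) \<open>b \<in> B\<close> by blast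
      ultimately show False using x(2) by linarith
    qed
    moreover have "n \<in> A'" using that unfolding A'_def by auto
    moreover have "?p n = pos n" by simp
    ultimately show ?thesis unfolding ball pS using pO by (metis order_less_irrefl)
  qed
  ultimately have "tree_state (Suc n) ?p (f(Suc n := s)) (g(Suc n := s')) A' T (r \<and> j = card B + 1) True"
    unfolding tree_state_def using s s' by auto
  then show ?thesis using t(2,3) cA T(2) by blast
qed

lemma left_child:
  assumes st: "tree_state n pos f g A B l r" and j: "j \<in> {1..card A + 1}"
  shows "\<exists>t s s' B'. t < pos n \<and> card B' = card B + of_bool l \<and> card {a\<in>A. pos a < t} = j - 1 \<and>
    tree_state (Suc n) (pos(Suc n := t)) (f(Suc n := s)) (g(Suc n := s')) {a\<in>A. pos a < t} B'
      True (l \<and> j = card A + 1)"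
proof -
  obtain t s s' A' where *: "- pos n < t" "card A' = card B + of_bool l"
    "card {b\<in>A. t < - pos b} = j - 1"
    "tree_state (Suc n) ((\<lambda>x. - pos x)(Suc n := t)) (g(Suc n := s)) (f(Suc n := s')) A'
       {b\<in>A. t < - pos b} (l \<and> j = card A + 1) True"
    using right_child[OF tree_state_mirror[OF st] j] by blast
  have 1: "(\<lambda>x. - ((\<lambda>x. - pos x)(Suc n := t)) x) = pos(Suc n := - t)" by auto
  have 2: "{b\<in>A. t < - pos b} = {a\<in>A. pos a < - t}" by auto
  have "tree_state (Suc n) (pos(Suc n := - t)) (f(Suc n := s')) (g(Suc n := s))
     {a\<in>A. pos a < - t} A' True (l \<and> j = card A + 1)"
    using tree_state_mirror[OF *(4)] unfolding 1 2 .
  then show ?thesis using * unfolding 2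
    by (intro exI[of _ "- t"] exI[of _ s'] exI[of _ s] exI[of _ A']) auto
qed

section \<open>Rigid placements\<close>

definition forced :: "nat \<Rightarrow> placement \<Rightarrow> direction \<Rightarrow> (nat \<times> nat) set" where
  "forced n P d = {(i, j) \<in> off_diagonal n. spatial_rel P d i j \<and> (\<forall>d'. spatial_rel P d' i j \<longrightarrow> d' = d)}"

text \<open>The closures ask for forced relations only along chains generating the two orders; pairs
  joined by longer chains may satisfy several relations.\<close>

definition rigid :: "nat \<Rightarrow> placement \<Rightarrow> (nat \<times> nat) set \<Rightarrow> (nat \<times> nat) set \<Rightarrow> bool" where
  "rigid n P W S \<longleftrightarrow> is_placement n P \<and> trans W \<and> trans S \<and>
     off_diagonal n \<subseteq> W \<union> W\<inverse> \<union> S \<union> S\<inverse> \<and>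
     W \<subseteq> (forced n P West)\<^sup>+ \<and> S \<subseteq> (forced n P South)\<^sup>+"

lemma spatial_rel_swap:
  "spatial_rel P East i j \<longleftrightarrow> spatial_rel P West j i"
  "spatial_rel P North i j \<longleftrightarrow> spatial_rel P South j i"
  by auto

lemma trancl_spatial_rel:
  assumes "is_placement n P" "d = West \<or> d = South" "(i, j) \<in> F\<^sup>+"
    and F: "\<And>i j. (i, j) \<in> F \<Longrightarrow> (i, j) \<in> off_diagonal n \<and> spatial_rel P d i j"
  shows "spatial_rel P d i j"
  using assms(3)
proof (induction rule: trancl_induct)
  case (base y)
  then show ?case using F by blast
next
  case (step y z)
  have "y \<in> {1..n}" using F[OF step.hyps(2)] unfolding off_diagonal_def by auto
  then have "xmin P y < xmax P y" "ymin P y < ymax P y" using assms(1) unfolding is_placement_def by auto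
  then show ?case using assms(2) step.IH F[OF step.hyps(2)] by auto
qed

lemma rigid_feasible:
  assumes "rigid n P W S"
  shows "feasible n P"
proof -
  have "spatial_rel P West i j" if "(i, j) \<in> W" for i j
    using trancl_spatial_rel[of n P West i j "forced n P West"] assms that
    unfolding rigid_def forced_def by blast
  moreover have "spatial_rel P South i j" if "(i, j) \<in> S" for i j
    using trancl_spatial_rel[of n P South i j "forced n P South"] assms that
    unfolding rigid_def forced_def by blast
  ultimately have "\<exists>d. spatial_rel P d i j" if "(i, j) \<in> off_diagonal n" for i j
    using assms that spatial_rel_swap unfolding rigid_def by (metis (no_types, lifting) UnE converse_iff subsetD)
  then show ?thesis using assms unfolding feasible_def rigid_def by blast
qed

text \<open>A common representation carries relations forced in \<open>P'\<close> over to
  \<open>P\<close>, where they propagate along chains. So all of \<open>W'\<close> and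
  \<open>S'\<close> holds in \<open>P\<close>. A pair forced west in \<open>P\<close> is comparable
  in \<open>W'\<close> or \<open>S'\<close>, and any place other than \<open>W'\<close> would give
  it a second relation in \<open>P\<close>.\<close>

lemma rigid_subset:
  assumes P: "rigid n P W S" and P': "rigid n P' W' S'"
    and r: "represents n r P" "represents n r P'"
  shows "W \<subseteq> W' \<and> S \<subseteq> S'"
proof -
  have transfer: "spatial_rel P d i j"
    if "represents n r P" "is_placement n P" "d = West \<or> d = South" "represents n r P'" "(i, j) \<in> (forced n P' d)\<^sup>+"
    for P P' d i j
  proof (rule trancl_spatial_rel[OF that(2,3,5)])
    fix i j assume f: "(i, j) \<in> forced n P' d"
    then have o: "(i, j) \<in> off_diagonal n" unfolding forced_def by blast
    have "r (i, j) = d" using f that(4) o unfolding forced_def represents_def by blast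
    then show "(i, j) \<in> off_diagonal n \<and> spatial_rel P d i j" using o that(1) unfolding represents_def by blast
  qed
  have sp: "\<And>i j. (i, j) \<in> W' \<Longrightarrow> spatial_rel P West i j"
       "\<And>i j. (i, j) \<in> S' \<Longrightarrow> spatial_rel P South i j"
    using transfer[of P _ P'] P P' r unfolding rigid_def by blast+
  have cover: "(i, j) \<in> W' \<or> (j, i) \<in> W' \<or> (i, j) \<in> S' \<or> (j, i) \<in> S'" if "(i, j) \<in> off_diagonal n" for i j
    using P' that unfolding rigid_def by blast
  have W: "forced n P West \<subseteq> W'"
  proof
    fix x assume x: "x \<in> forced n P West"
    obtain i j where ij: "x = (i, j)" by fastforce
    have "(i, j) \<in> off_diagonal n" and u: "\<And>d'. spatial_rel P d' i j \<Longrightarrow> d' = West"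
      using x unfolding forced_def ij by blast+
    then show "x \<in> W'"
      using cover[of i j] sp u[of East] u[of South] u[of North] spatial_rel_swap unfolding ij by blast
  qed
  have S: "forced n P South \<subseteq> S'"
  proof
    fix x assume x: "x \<in> forced n P South"
    obtain i j where ij: "x = (i, j)" by fastforce
    have "(i, j) \<in> off_diagonal n" and u: "\<And>d'. spatial_rel P d' i j \<Longrightarrow> d' = South"
      using x unfolding forced_def ij by blast+
    then show "x \<in> S'"
      using cover[of i j] sp u[of East] u[of West] u[of North] spatial_rel_swap unfolding ij by blast
  qed
  have "(forced n P West)\<^sup>+ \<subseteq> W'" "(forced n P South)\<^sup>+ \<subseteq> S'"
    using W S P' trancl_id[of W'] trancl_id[of S'] trancl_mono unfolding rigid_def by (metis subsetI)+
  then show ?thesis using P unfolding rigid_def by blast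
qed

lemma rigid_unique:
  assumes "rigid n P W S" "rigid n P' W' S'" "represents n r P" "represents n r P'"
  shows "W = W' \<and> S = S'"
  using rigid_subset[OF assms] rigid_subset[OF assms(2,1,4,3)] by blast

text \<open>With \<open>inv s\<close>, the label \<open>s i\<close> carries the rectangle of
  \<open>i\<close>.\<close>

definition relabel :: "(nat \<Rightarrow> nat) \<Rightarrow> placement \<Rightarrow> placement" where
  "relabel s P = \<lparr>xmin = xmin P \<circ> inv s, ymin = ymin P \<circ> inv s, xmax = xmax P \<circ> inv s, ymax = ymax P \<circ> inv s\<rparr>"

lemma rigid_relabel:
  assumes s: "s permutes {1..n}" and P: "rigid n P W S"
  shows "rigid n (relabel s P) (map_prod s s ` W) (map_prod s s ` S)"
proof -
  have inv: "inv s (s i) = i" "s (inv s i) = i" for i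
    using s by (auto simp: permutes_inverses)
  have bij: "inj s" using s permutes_inj by blast
  have im: "i \<in> {1..n} \<longleftrightarrow> s i \<in> {1..n}" for i using permutes_in_image[OF s] by simp
  have sr: "spatial_rel (relabel s P) d (s i) (s j) = spatial_rel P d i j" for d i j
    by (cases d) (auto simp: relabel_def inv)
  have od: "(s i, s j) \<in> off_diagonal n \<longleftrightarrow> (i, j) \<in> off_diagonal n" for i j
    unfolding off_diagonal_def using im inj_eq[OF bij] by auto
  have "(s i, s j) \<in> (forced n (relabel s P) d)\<^sup>+" if "(i, j) \<in> (forced n P d)\<^sup>+" for i j d
    using that
  proof (induction rule: trancl_induct)
    case (base y)
    then show ?case unfolding forced_def using sr od by (intro r_into_trancl) auto
  next
    case (step y z)
    have "(s y, s z) \<in> forced n (relabel s P) d" using step.hyps(2) unfolding forced_def using sr od by auto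
    then show ?case using step.IH by simp
  qed
  then have "map_prod s s ` W \<subseteq> (forced n (relabel s P) West)\<^sup>+"
      "map_prod s s ` S \<subseteq> (forced n (relabel s P) South)\<^sup>+"
    using P unfolding rigid_def by auto
  moreover have "trans (map_prod s s ` V)" if "trans V" for V
    using that bij unfolding trans_def by (auto simp: inj_eq)
  moreover have "off_diagonal n \<subseteq> map_prod s s ` W \<union> (map_prod s s ` W)\<inverse> \<union> map_prod s s ` S \<union> (map_prod s s ` S)\<inverse>"
  proof
    fix x assume x: "x \<in> off_diagonal n"
    obtain i j where ij: "x = (s i, s j)" using inv(2) by (metis surj_pair)
    then have "(i, j) \<in> off_diagonal n" using x od by simp
    then have "(i, j) \<in> W \<or> (j, i) \<in> W \<or> (i, j) \<in> S \<or> (j, i) \<in> S" using P unfolding rigid_def by blast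
    then show "x \<in> map_prod s s ` W \<union> (map_prod s s ` W)\<inverse> \<union> map_prod s s ` S \<union> (map_prod s s ` S)\<inverse>"
      unfolding ij by force
  qed
  moreover have "is_placement n (relabel s P)"
  proof -
    have "inv s i \<in> {1..n}" if "i \<in> {1..n}" for i using im[of "inv s i"] that inv by simp
    then show ?thesis using P unfolding rigid_def is_placement_def relabel_def by simp
  qed
  ultimately show ?thesis using P unfolding rigid_def by blast
qed

section \<open>From permutations to rigid placements\<close>

definition west_pairs :: "nat \<Rightarrow> (nat \<Rightarrow> real) \<Rightarrow> (nat \<times> nat) set" where
  "west_pairs n pos = {(j, i). j \<in> {1..n} \<and> i \<in> {1..n} \<and> j < i \<and> pos j < pos i}"

lemma west_pairs_covers:
  assumes "(j, i) \<in> west_pairs n pos"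
  shows "(j, i) \<in> {(j, i). j \<in> {1..n} \<and> i \<in> {1..n} \<and> cover pos j i}\<^sup>+"
  using assms
proof (induction "i - j" arbitrary: i j rule: less_induct)
  case less
  show ?case
  proof (cases "cover pos j i")
    case True
    then show ?thesis using less.prems unfolding west_pairs_def by (intro r_into_trancl) auto
  next
    case False
    then obtain m where m: "j < m" "m < i" "pos j < pos m" "pos m < pos i"
      using less.prems unfolding west_pairs_def cover_def by blast
    then have "(j, m) \<in> west_pairs n pos" "(m, i) \<in> west_pairs n pos"
      using less.prems unfolding west_pairs_def by auto
    then show ?thesis using less.hyps[of m j] less.hyps[of i m] m
      by (meson diff_less_mono diff_less_mono2 less_imp_le trancl_trans less_trans)
  qed
qed

text \<open>Rectangles are extended until they meet the first successor, to overlap as much as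
  possible; the last clause says that nothing else stops them.\<close>

lemma ex_upper_ends:
  fixes f :: "nat \<Rightarrow> real"
  assumes "\<And>i j. i \<in> {1..n} \<Longrightarrow> j \<in> {1..n} \<Longrightarrow> j < i \<Longrightarrow> pos j < pos i \<Longrightarrow> f j < f i"
  shows "\<exists>h. (\<forall>j\<in>{1..n}. f j < h j) \<and> (\<forall>(j, i)\<in>west_pairs n pos. h j \<le> f i) \<and>
    (\<forall>j\<in>{1..n}. \<forall>k\<in>{1..n}. h j \<le> f k \<longrightarrow> (\<exists>i. (j, i) \<in> west_pairs n pos \<and> f i \<le> f k))"
proof -
  \<comment> \<open>Default upper end of elements without successors; being above all values of
    \<open>f\<close>, it never satisfies \<open>h j \<le> f k\<close>.\<close>
  obtain s where s: "\<forall>x\<in>{1..n}. f x < s" using ex_between[of "{1..n}" "{}" f] by auto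
  define h where "h j = Min (insert s (f ` {i. (j, i) \<in> west_pairs n pos}))" for j
  have fin: "finite {i. (j, i) \<in> west_pairs n pos}" for j
    by (rule finite_subset[of _ "{1..n}"]) (auto simp: west_pairs_def)
  have "f j < h j" if "j \<in> {1..n}" for j
    unfolding h_def using fin[of j] s that assms by (auto simp: west_pairs_def)
  moreover have "h j \<le> f i" if "(j, i) \<in> west_pairs n pos" for i j
    unfolding h_def using fin[of j] that by auto
  moreover have "\<exists>i. (j, i) \<in> west_pairs n pos \<and> f i \<le> f k" if "h j \<le> f k" "k \<in> {1..n}" for j k
  proof -
    have "h j \<in> insert s (f ` {i. (j, i) \<in> west_pairs n pos})"
      unfolding h_def using fin[of j] by (intro Min_in) auto
    moreover have "h j \<noteq> s" using that s by force
    ultimately show ?thesis using that by auto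
  qed
  ultimately show ?thesis by blast
qed

lemma levels_rigid:
  assumes inj: "inj_on pos {1..n}" and g: "levels n pos g" and f: "levels n (\<lambda>x. - pos x) f"
  shows "\<exists>P. rigid n P (west_pairs n pos) (west_pairs n (\<lambda>x. - pos x))"
proof -
  let ?q = "\<lambda>x. - pos x"
  have inj': "inj_on ?q {1..n}" using inj unfolding inj_on_def neg_equal_iff_equal by blast
  have g1: "g j < g i" if "i \<in> {1..n}" "j \<in> {1..n}" "j < i" "?q j < ?q i" for i j
    using g that unfolding levels_def by (auto simp del: atLeastAtMost_iff)
  have f1: "f j < f i" if "i \<in> {1..n}" "j \<in> {1..n}" "j < i" "pos j < pos i" for i j
    using f that unfolding levels_def by (auto simp del: atLeastAtMost_iff)
  obtain F where F: "\<forall>j\<in>{1..n}. f j < F j" "\<And>i j. (j, i)\<in>west_pairs n pos \<Longrightarrow> F j \<le> f i"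
    "\<And>j k. j\<in>{1..n} \<Longrightarrow> k\<in>{1..n} \<Longrightarrow> F j \<le> f k \<Longrightarrow> (\<exists>i. (j, i) \<in> west_pairs n pos \<and> f i \<le> f k)"
    using ex_upper_ends[of n pos f] f1 by blast
  obtain G where G: "\<forall>j\<in>{1..n}. g j < G j" "\<And>i j. (j, i)\<in>west_pairs n ?q \<Longrightarrow> G j \<le> g i"
    "\<And>j k. j\<in>{1..n} \<Longrightarrow> k\<in>{1..n} \<Longrightarrow> G j \<le> g k \<Longrightarrow> (\<exists>i. (j, i) \<in> west_pairs n ?q \<and> g i \<le> g k)"
    using ex_upper_ends[of n ?q g] g1 by blast
  \<comment> \<open>Stated for arbitrary \<open>p\<close> and coordinates, to serve west covers and,
    with the coordinates exchanged, south covers.\<close>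
  have clear: "\<not> G j \<le> g i \<and> \<not> G i \<le> g j \<and> \<not> F i \<le> f j"
    if ij: "i \<in> {1..n}" "j \<in> {1..n}" and c: "cover p j i" and ip: "inj_on p {1..n}"
      and lev: "levels n p g" and p1: "\<And>i j. i \<in> {1..n} \<Longrightarrow> j \<in> {1..n} \<Longrightarrow> j < i \<Longrightarrow> p j < p i \<Longrightarrow> f j < f i"
      and F1: "\<forall>j\<in>{1..n}. f j < F j"
      and G3: "\<And>j k. j\<in>{1..n} \<Longrightarrow> k\<in>{1..n} \<Longrightarrow> G j \<le> g k \<Longrightarrow> (\<exists>i. (j, i) \<in> west_pairs n (\<lambda>x. - p x) \<and> g i \<le> g k)"
    for i j and p f F g G :: "nat \<Rightarrow> real"
  proof (intro conjI notI)
    have ji: "j < i" "p j < p i" using c unfolding cover_def by auto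
    have L1: "\<And>i j. i \<in> {1..n} \<Longrightarrow> j \<in> {1..n} \<Longrightarrow> i < j \<Longrightarrow> p j < p i \<Longrightarrow> g i < g j"
      and L2: "\<And>i j z. i \<in> {1..n} \<Longrightarrow> j \<in> {1..n} \<Longrightarrow> z \<in> {1..n} \<Longrightarrow> cover p j i \<Longrightarrow> p z < p j
       \<Longrightarrow> j < z \<Longrightarrow> z < i \<Longrightarrow> g i < g z"
      and L3: "\<And>i j z. i \<in> {1..n} \<Longrightarrow> j \<in> {1..n} \<Longrightarrow> z \<in> {1..n} \<Longrightarrow> cover p j i \<Longrightarrow> p j < p z
       \<Longrightarrow> p z < p i \<Longrightarrow> i < z \<Longrightarrow> g j < g z"
      using lev unfolding levels_def by blast+
    { assume "G j \<le> g i"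
      then obtain z where z: "(j, z) \<in> west_pairs n (\<lambda>x. - p x)" "g z \<le> g i" using G3 ij by blast
      then have z': "z \<in> {1..n}" "j < z" "p z < p j" unfolding west_pairs_def by auto
      \<comment> \<open>Below \<open>i\<close> the second clause of \<open>levels\<close> applies;
        above \<open>i\<close>, the element \<open>z\<close> is north of \<open>i\<close> too and
        the first clause does.\<close>
      consider "z < i" | "i < z" using z' ji by force
      then show False
        using L2[OF ij z'(1) c] L1[OF ij(1) z'(1)] z z' ji by cases auto }
    { assume "G i \<le> g j"
      then obtain z where z: "(i, z) \<in> west_pairs n (\<lambda>x. - p x)" "g z \<le> g j" using G3 ij by blast
      then have z': "z \<in> {1..n}" "i < z" "p z < p i" unfolding west_pairs_def by auto
      consider "p z < p j" | "p j < p z" | "p z = p j" by force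
      then show False
      proof cases
        case 1 then show False using L1[OF ij(2) z'(1)] z z' ji by auto
      next
        case 2 then show False using L3[OF ij z'(1) c] z z' by auto
      next
        case 3 then show False using inj_onD[OF ip, of z j] z' ij ji by simp
      qed }
    { assume "F i \<le> f j"
      then show False using p1[OF ij ji] F1 ij by force }
  qed
  have cov: "west_pairs n p \<subseteq> F\<^sup>+"
    if "{(j, i). j \<in> {1..n} \<and> i \<in> {1..n} \<and> cover p j i} \<subseteq> F" for p F
  proof (rule subrelI)
    fix j i assume "(j, i) \<in> west_pairs n p"
    from trancl_mono[OF west_pairs_covers[OF this] that] show "(j, i) \<in> F\<^sup>+" .
  qed
  define P where "P = \<lparr>xmin = f, ymin = g, xmax = F, ymax = G\<rparr>"
  have od: "(j, i) \<in> off_diagonal n" if "j \<in> {1..n}" "i \<in> {1..n}" "cover p j i" for i j p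
    using that unfolding off_diagonal_def cover_def by auto
  have wp: "(j, i) \<in> west_pairs n p" if "j \<in> {1..n}" "i \<in> {1..n}" "cover p j i" for i j p
    using that unfolding west_pairs_def cover_def by auto
  have c1: "{(j, i). j \<in> {1..n} \<and> i \<in> {1..n} \<and> cover pos j i} \<subseteq> forced n P West"
  proof clarify
    fix j i assume ij: "j \<in> {1..n}" "i \<in> {1..n}" and c: "cover pos j i"
    have "d' = West" if "spatial_rel P d' j i" for d'
      using that clear[OF ij(2,1) c inj g f1 F(1) G(3)] by (cases d') (auto simp: P_def)
    then show "(j, i) \<in> forced n P West"
      unfolding forced_def using od[OF ij c] F(2)[OF wp[OF ij c]] by (auto simp: P_def)
  qed
  have c2: "{(j, i). j \<in> {1..n} \<and> i \<in> {1..n} \<and> cover ?q j i} \<subseteq> forced n P South"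
  proof clarify
    fix j i assume ij: "j \<in> {1..n}" "i \<in> {1..n}" and c: "cover ?q j i"
    have "d' = South" if "spatial_rel P d' j i" for d'
      using that clear[OF ij(2,1) c inj' f g1 G(1)] F(3) by (cases d') (auto simp: P_def)
    then show "(j, i) \<in> forced n P South"
      unfolding forced_def using od[OF ij c] G(2)[OF wp[OF ij c]] by (auto simp: P_def)
  qed
  have "west_pairs n pos \<subseteq> (forced n P West)\<^sup>+" "west_pairs n ?q \<subseteq> (forced n P South)\<^sup>+"
    by (rule cov[OF c1], rule cov[OF c2])
  moreover have "trans (west_pairs n p)" for p
    unfolding west_pairs_def trans_def by auto
  moreover have "off_diagonal n \<subseteq> west_pairs n pos \<union> (west_pairs n pos)\<inverse> \<union> west_pairs n ?q \<union> (west_pairs n ?q)\<inverse>"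
  proof (rule subrelI)
    fix i j assume o: "(i, j) \<in> off_diagonal n"
    have "pos i \<noteq> pos j" using inj_onD[OF inj, of i j] o unfolding off_diagonal_def by blast
    then show "(i, j) \<in> west_pairs n pos \<union> (west_pairs n pos)\<inverse> \<union> west_pairs n ?q \<union> (west_pairs n ?q)\<inverse>"
      using o unfolding off_diagonal_def west_pairs_def by auto
  qed
  moreover have "is_placement n P" unfolding is_placement_def P_def using F(1) G(1) by auto
  ultimately show ?thesis unfolding rigid_def by blast
qed

text \<open>The west order determines the south order as its complement among the pairs
  \<open>j < i\<close>. Counting orders instead of position functions identifies all
  \<open>pos\<close> that describe the same permutation.\<close>

definition rigid_orders :: "nat \<Rightarrow> (nat \<times> nat) set set" where
  "rigid_orders n = {west_pairs n pos | pos. inj_on pos {1..n} \<and>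
     (\<exists>f g. levels n pos g \<and> levels n (\<lambda>x. - pos x) f)}"

lemma finite_rigid_orders: "finite (rigid_orders n)"
  by (rule finite_subset[of _ "Pow ({1..n} \<times> {1..n})"]) (auto simp: rigid_orders_def west_pairs_def)

text \<open>In the transported linear order \<open>u k\<close> has exactly \<open>k - 1\<close>
  predecessors, so the order determines \<open>u\<close>.\<close>

lemma permutes_eqI:
  assumes s: "s permutes {1..n::nat}" and t: "t permutes {1..n}"
    and eq: "{(s j, s i) | i j. j \<in> {1..n} \<and> i \<in> {1..n} \<and> j < i} = {(t j, t i) | i j. j \<in> {1..n} \<and> i \<in> {1..n} \<and> j < i}"
  shows "s = t"
proof -
  have *: "card {l. (l, u k) \<in> {(u j, u i) | i j. j \<in> {1..n} \<and> i \<in> {1..n} \<and> j < i}} = k - 1"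
    if "u permutes {1..n}" "k \<in> {1..n}" for u k
  proof -
    have inj: "inj u" using that permutes_inj by blast
    have "{l. (l, u k) \<in> {(u j, u i) | i j. j \<in> {1..n} \<and> i \<in> {1..n} \<and> j < i}} = u ` {1..<k}"
      using that(2) inj by (auto simp: inj_eq)
    then show ?thesis using card_image[of u "{1..<k}"] inj by (simp add: inj_on_subset)
  qed
  have "s i = t i" for i
  proof (cases "i \<in> {1..n}")
    case True
    then have "s i \<in> {1..n}" using permutes_in_image[OF s] by simp
    then obtain k where k: "k \<in> {1..n}" "t k = s i" using permutes_image[OF t] by (metis imageE)
    have "i - 1 = k - 1" using *[OF s True, unfolded eq] *[OF t k(1), unfolded k(2)] by (simp only:)
    then show ?thesis using True k by (cases "i = k") auto
  next
    case False
    then show ?thesis using s t by (simp add: permutes_not_in)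
  qed
  then show ?thesis by auto
qed

text \<open>Each labelled rigid order is sent to a representation of one of its rigid placements.
  This is injective: by \<open>rigid_unique\<close> the representation determines both transported
  orders, their union is a transported linear order and yields the labelling, and undoing the
  labelling yields \<open>W\<close>.\<close>

lemma card_complete_representations:
  assumes R: "complete_representations n R"
  shows "fact n * card (rigid_orders n) \<le> card R"
proof -
  have "finite (off_diagonal n)"
    by (rule finite_subset[of _ "{1..n} \<times> {1..n}"]) (auto simp: off_diagonal_def)
  moreover have "finite (UNIV :: direction set)"
  proof -
    have "(UNIV :: direction set) = {West, South, East, North}" using direction.exhaust by auto
    then show ?thesis by (metis finite.simps)
  qed
  ultimately have "finite (representation_functions n)"
    unfolding representation_functions_def by (intro finite_PiE) auto
  then have finR: "finite R" using R finite_subset unfolding complete_representations_def by blast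
  let ?S = "\<lambda>W. {(j, i). j \<in> {1..n} \<and> i \<in> {1..n} \<and> j < i} - W"
  have ex: "\<exists>r\<in>R. \<exists>P. represents n r P \<and> rigid n P (map_prod s s ` W) (map_prod s s ` ?S W)"
    if s: "s permutes {1..n}" and W: "W \<in> rigid_orders n" for s W
  proof -
    obtain pos f g where pos: "W = west_pairs n pos" "inj_on pos {1..n}" "levels n pos g" "levels n (\<lambda>x. - pos x) f"
      using W unfolding rigid_orders_def by blast
    have "pos j < pos i \<or> pos i < pos j" if "i \<in> {1..n}" "j \<in> {1..n}" "j < i" for i j
      using inj_onD[OF pos(2), of i j] that by force
    then have "west_pairs n (\<lambda>x. - pos x) = ?S W"
      unfolding pos(1) west_pairs_def by fastforce
    then obtain P where "rigid n P W (?S W)" using levels_rigid[OF pos(2-4)] pos(1) by auto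
    then have *: "rigid n (relabel s P) (map_prod s s ` W) (map_prod s s ` ?S W)"
      using rigid_relabel s by blast
    then show ?thesis using R rigid_feasible[OF *] unfolding complete_representations_def by blast
  qed
  define Q where "Q = (\<lambda>(s, W). SOME r. r \<in> R \<and> (\<exists>P. represents n r P \<and> rigid n P (map_prod s s ` W) (map_prod s s ` ?S W)))"
  let ?D = "{s. s permutes {1..n}} \<times> rigid_orders n"
  have Q: "Q (s, W) \<in> R \<and> (\<exists>P. represents n (Q (s, W)) P \<and> rigid n P (map_prod s s ` W) (map_prod s s ` ?S W))"
    if "(s, W) \<in> ?D" for s W
  proof -
    have "\<exists>r. r \<in> R \<and> (\<exists>P. represents n r P \<and> rigid n P (map_prod s s ` W) (map_prod s s ` ?S W))"
      using ex that by blast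
    from someI_ex[OF this] show ?thesis unfolding Q_def by simp
  qed
  have "inj_on Q ?D"
  proof (rule inj_onI, clarify)
    fix s W s' W' assume s: "s permutes {1..n}" "s' permutes {1..n}" and W: "W \<in> rigid_orders n" "W' \<in> rigid_orders n"
      and eq: "Q (s, W) = Q (s', W')"
    have im: "map_prod s s ` W = map_prod s' s' ` W'" "map_prod s s ` ?S W = map_prod s' s' ` ?S W'"
      using Q[of s W] Q[of s' W'] s W eq rigid_unique by (metis (no_types, lifting) mem_Collect_eq mem_Sigma_iff)+
    have un: "map_prod u u ` V \<union> map_prod u u ` ?S V = {(u j, u i) | i j. j \<in> {1..n} \<and> i \<in> {1..n} \<and> j < i}"
      if "V \<in> rigid_orders n" for u :: "nat \<Rightarrow> nat" and V
    proof -
      have "V \<union> ?S V = {(j, i). j \<in> {1..n} \<and> i \<in> {1..n} \<and> j < i}"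
        using that unfolding rigid_orders_def west_pairs_def by auto
      then have "map_prod u u ` V \<union> map_prod u u ` ?S V = map_prod u u ` {(j, i). j \<in> {1..n} \<and> i \<in> {1..n} \<and> j < i}"
        by (metis image_Un)
      then show ?thesis by auto
    qed
    have "s = s'" using permutes_eqI[OF s] un[OF W(1), of s] un[OF W(2), of s'] im by simp
    moreover have "inj (map_prod s s)" using permutes_inj[OF s(1)] prod.inj_map by blast
    ultimately show "s = s' \<and> W = W'" using im(1) by (simp add: inj_image_eq_iff)
  qed
  moreover have "Q ` ?D \<subseteq> R" using Q by auto
  ultimately have "card ?D \<le> card R" using card_inj_on_le finR by blast
  then show ?thesis using card_permutations[of "{1..n}" n] by (simp add: card_cartesian_product)
qed

section \<open>The generating tree\<close>

text \<open>Descendants at depth \<open>m\<close> of a state with \<open>p\<close> left and \<open>q\<close> right active sites, ends included;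
  \<open>l\<close> and \<open>r\<close> are the flags of \<^const>\<open>tree_state\<close>.\<close>

fun tree_count :: "nat \<Rightarrow> nat \<Rightarrow> nat \<Rightarrow> bool \<Rightarrow> bool \<Rightarrow> nat" where
  "tree_count 0 p q l r = 1"
| "tree_count (Suc m) p q l r =
     (\<Sum>j\<in>{1..q}. tree_count m (p + of_bool r) j (r \<and> j = q) True) +
     (\<Sum>j\<in>{1..p}. tree_count m j (q + of_bool l) True (l \<and> j = p))"

lemma west_pairs_restrict:
  "n \<le> m \<Longrightarrow> west_pairs m pos \<inter> {(i, k). k \<le> n} = west_pairs n pos"
  unfolding west_pairs_def by auto

lemma west_pairs_upd: "west_pairs n (pos(Suc n := t)) = west_pairs n pos"
  unfolding west_pairs_def by auto

lemma sum_card_fibres_le: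
  assumes "finite D" "finite J" "\<And>j. j \<in> J \<Longrightarrow> h j \<le> card {W \<in> D. P W \<and> F W = j - (1::nat)}" "0 \<notin> J"
  shows "(\<Sum>j\<in>J. h j) \<le> card {W \<in> D. P W}"
proof -
  have "(\<Sum>j\<in>J. h j) \<le> (\<Sum>j\<in>J. card {W \<in> D. P W \<and> F W = j - 1})" using assms(3) by (intro sum_mono) auto
  also have "\<dots> = card (\<Union>j\<in>J. {W \<in> D. P W \<and> F W = j - 1})"
  proof (rule card_UN_disjoint[symmetric])
    \<comment> \<open>Excluding 0 keeps the truncated \<open>j - 1\<close> injective on
      \<open>J\<close>.\<close>
    have "j = j'" if "j \<in> J" "j' \<in> J" "j - 1 = j' - 1" for j j'
      using that assms(4) by (metis One_nat_def Suc_pred not_gr_zero)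
    then show "\<forall>i\<in>J. \<forall>j\<in>J. i \<noteq> j \<longrightarrow> {W \<in> D. P W \<and> F W = i - 1} \<inter> {W \<in> D. P W \<and> F W = j - 1} = {}"
      by fastforce
  qed (use assms(1,2) in auto)
  also have "\<dots> \<le> card {W \<in> D. P W}" using assms(1) by (intro card_mono) auto
  finally show ?thesis .
qed

text \<open>Different children have disjoint sets of descendants because \<open>W\<close> itself
  tells them apart: whether \<open>n\<close> is west of \<open>Suc n\<close> gives the side, and the
  number of old sites beyond \<open>Suc n\<close> on that side gives \<open>j\<close>.\<close>

lemma tree_count_descendants:
  assumes "tree_state n pos f g A B l r"
  shows "tree_count m (card A + 1) (card B + 1) l r \<le>
    card {W \<in> rigid_orders (n + m). W \<inter> {(i, k). k \<le> n} = west_pairs n pos}"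
  using assms
proof (induction m arbitrary: n pos f g A B l r)
  case 0
  have "west_pairs n pos \<in> rigid_orders n"
    using 0 unfolding rigid_orders_def tree_state_def by blast
  then have "{west_pairs n pos} \<subseteq> {W \<in> rigid_orders (n + 0). W \<inter> {(i, k). k \<le> n} = west_pairs n pos}"
    using west_pairs_restrict[of n n] by auto
  from card_mono[OF _ this] finite_rigid_orders show ?case by simp
next
  case (Suc m)
  let ?D = "{W \<in> rigid_orders (n + Suc m). W \<inter> {(i, k). k \<le> n} = west_pairs n pos}"
  have sub: "A \<subseteq> {1..n}" "B \<subseteq> {1..n}" and n: "n \<ge> 1"
    using tree_state_subset[OF Suc.prems] Suc.prems unfolding tree_state_def by auto
  have finD: "finite ?D" using finite_rigid_orders by auto
  have desc: "W \<in> ?D \<and> (\<forall>x\<in>{1..n}. (x, Suc n) \<in> W \<longleftrightarrow> pos x < t)"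
    if "W \<in> rigid_orders (Suc n + m)" "W \<inter> {(i, k). k \<le> Suc n} = west_pairs (Suc n) (pos(Suc n := t))" for W t
  proof -
    have "W \<inter> {(i, k). k \<le> n} = (W \<inter> {(i, k). k \<le> Suc n}) \<inter> {(i, k). k \<le> n}" by auto
    also have "\<dots> = west_pairs n pos" unfolding that(2) by (simp add: west_pairs_restrict west_pairs_upd)
    finally have 1: "W \<in> ?D" using that(1) by simp
    have "(x, Suc n) \<in> W \<longleftrightarrow> (x, Suc n) \<in> W \<inter> {(i, k). k \<le> Suc n}" for x by simp
    then have "\<forall>x\<in>{1..n}. (x, Suc n) \<in> W \<longleftrightarrow> pos x < t" unfolding that(2) west_pairs_def by auto
    then show ?thesis using 1 by blast
  qed
  have nt: "pos x \<noteq> t" if "tree_state (Suc n) (pos(Suc n := t)) f' g' A' B' l' r'" "x \<in> {1..n}"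
    for t f' g' A' B' l' r' x
  proof
    assume "pos x = t"
    then have "(pos(Suc n := t)) x = (pos(Suc n := t)) (Suc n)" by auto
    moreover have "inj_on (pos(Suc n := t)) {1..Suc n}" using that(1) unfolding tree_state_def by blast
    ultimately have "x = Suc n" using that(2) by (intro inj_onD[of "pos(Suc n := t)"]) auto
    then show False using that(2) by simp
  qed
  have right: "tree_count m (card A + 1 + of_bool r) j (r \<and> j = card B + 1) True
    \<le> card {W \<in> ?D. (n, Suc n) \<in> W \<and> card {b\<in>B. (b, Suc n) \<notin> W} = j - 1}" if j: "j \<in> {1..card B + 1}" for j
  proof -
    obtain t s s' A' where t: "pos n < t" "card A' = card A + of_bool r" "card {b\<in>B. t < pos b} = j - 1"
      and st: "tree_state (Suc n) (pos(Suc n := t)) (f(Suc n := s)) (g(Suc n := s')) A' {b\<in>B. t < pos b}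
        (r \<and> j = card B + 1) True"
      using right_child[OF Suc.prems j] by blast
    have jj: "j - 1 + 1 = j" using j by simp
    have e: "card A' + 1 = card A + 1 + of_bool r" using t(2) by simp
    have "tree_count m (card A + 1 + of_bool r) j (r \<and> j = card B + 1) True
      \<le> card {W \<in> rigid_orders (Suc n + m). W \<inter> {(i, k). k \<le> Suc n} = west_pairs (Suc n) (pos(Suc n := t))}"
      using Suc.IH[OF st] unfolding e t(3) jj .
    also have "\<dots> \<le> card {W \<in> ?D. (n, Suc n) \<in> W \<and> card {b\<in>B. (b, Suc n) \<notin> W} = j - 1}"
    proof (rule card_mono)
      show "{W \<in> rigid_orders (Suc n + m). W \<inter> {(i, k). k \<le> Suc n} = west_pairs (Suc n) (pos(Suc n := t))}
        \<subseteq> {W \<in> ?D. (n, Suc n) \<in> W \<and> card {b\<in>B. (b, Suc n) \<notin> W} = j - 1}"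
      proof
        fix W assume "W \<in> {W \<in> rigid_orders (Suc n + m). W \<inter> {(i, k). k \<le> Suc n} = west_pairs (Suc n) (pos(Suc n := t))}"
        then have W: "W \<in> ?D" "\<And>x. x \<in> {1..n} \<Longrightarrow> (x, Suc n) \<in> W \<longleftrightarrow> pos x < t" using desc by blast+
        have "(b, Suc n) \<notin> W \<longleftrightarrow> t < pos b" if "b \<in> B" for b
        proof -
          have b: "b \<in> {1..n}" using that sub(2) by blast
          show ?thesis unfolding W(2)[OF b] using nt[OF st b] by linarith
        qed
        then have "{b\<in>B. (b, Suc n) \<notin> W} = {b\<in>B. t < pos b}" by blast
        then show "W \<in> {W \<in> ?D. (n, Suc n) \<in> W \<and> card {b\<in>B. (b, Suc n) \<notin> W} = j - 1}"
          using W t n by auto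
      qed
    qed (use finite_rigid_orders in auto)
    finally show ?thesis .
  qed
  have left: "tree_count m j (card B + 1 + of_bool l) True (l \<and> j = card A + 1)
    \<le> card {W \<in> ?D. (n, Suc n) \<notin> W \<and> card {a\<in>A. (a, Suc n) \<in> W} = j - 1}" if j: "j \<in> {1..card A + 1}" for j
  proof -
    obtain t s s' B' where t: "t < pos n" "card B' = card B + of_bool l" "card {a\<in>A. pos a < t} = j - 1"
      and st: "tree_state (Suc n) (pos(Suc n := t)) (f(Suc n := s)) (g(Suc n := s')) {a\<in>A. pos a < t} B'
        True (l \<and> j = card A + 1)"
      using left_child[OF Suc.prems j] by blast
    have jj: "j - 1 + 1 = j" using j by simp
    have e: "card B' + 1 = card B + 1 + of_bool l" using t(2) by simp
    have "tree_count m j (card B + 1 + of_bool l) True (l \<and> j = card A + 1)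
      \<le> card {W \<in> rigid_orders (Suc n + m). W \<inter> {(i, k). k \<le> Suc n} = west_pairs (Suc n) (pos(Suc n := t))}"
      using Suc.IH[OF st] unfolding e t(3) jj .
    also have "\<dots> \<le> card {W \<in> ?D. (n, Suc n) \<notin> W \<and> card {a\<in>A. (a, Suc n) \<in> W} = j - 1}"
    proof (rule card_mono)
      show "{W \<in> rigid_orders (Suc n + m). W \<inter> {(i, k). k \<le> Suc n} = west_pairs (Suc n) (pos(Suc n := t))}
        \<subseteq> {W \<in> ?D. (n, Suc n) \<notin> W \<and> card {a\<in>A. (a, Suc n) \<in> W} = j - 1}"
      proof
        fix W assume "W \<in> {W \<in> rigid_orders (Suc n + m). W \<inter> {(i, k). k \<le> Suc n} = west_pairs (Suc n) (pos(Suc n := t))}"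
        then have W: "W \<in> ?D" "\<And>x. x \<in> {1..n} \<Longrightarrow> (x, Suc n) \<in> W \<longleftrightarrow> pos x < t" using desc by blast+
        then have "{a\<in>A. (a, Suc n) \<in> W} = {a\<in>A. pos a < t}" using sub(1) by blast
        then show "W \<in> {W \<in> ?D. (n, Suc n) \<notin> W \<and> card {a\<in>A. (a, Suc n) \<in> W} = j - 1}"
          using W t n by auto
      qed
    qed (use finite_rigid_orders in auto)
    finally show ?thesis .
  qed
  have "tree_count (Suc m) (card A + 1) (card B + 1) l r
    \<le> card {W \<in> ?D. (n, Suc n) \<in> W} + card {W \<in> ?D. (n, Suc n) \<notin> W}"
    unfolding tree_count.simps
    by (intro add_mono sum_card_fibres_le[OF finD _ right] sum_card_fibres_le[OF finD _ left]) auto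
  also have "\<dots> = card ({W \<in> ?D. (n, Suc n) \<in> W} \<union> {W \<in> ?D. (n, Suc n) \<notin> W})"
    using finite_rigid_orders by (intro card_Un_disjoint[symmetric]) auto
  also have "\<dots> \<le> card ?D" using finD by (intro card_mono) auto
  finally show ?case .
qed

lemma tree_count_le_card_rigid_orders: "tree_count m 1 1 True True \<le> card (rigid_orders (Suc m))"
proof -
  have "tree_state 1 (\<lambda>_. 0) (\<lambda>_. 0) (\<lambda>_. 0) {} {} True True"
    unfolding tree_state_def levels_def by auto
  from tree_count_descendants[OF this, of m]
  have "tree_count m 1 1 True True \<le>
      card {W \<in> rigid_orders (Suc m). W \<inter> {(i, k). k \<le> 1} = west_pairs 1 (\<lambda>_. 0)}" by simp
  also have "\<dots> \<le> card (rigid_orders (Suc m))"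
    using finite_rigid_orders by (intro card_mono) auto
  finally show ?thesis .
qed

section \<open>Averages over roots of unity\<close>

definition unity_roots :: "nat \<Rightarrow> complex set" where
  "unity_roots N = {z. z ^ N = 1}"

lemma finite_unity_roots: "N > 0 \<Longrightarrow> finite (unity_roots N)"
  unfolding unity_roots_def by (rule finite_roots_unity) simp

lemma card_unity_roots: "N > 0 \<Longrightarrow> card (unity_roots N) = N"
  unfolding unity_roots_def by (rule card_roots_unity_eq)

lemma unity_roots_nonzero: "N > 0 \<Longrightarrow> z \<in> unity_roots N \<Longrightarrow> z \<noteq> 0"
  unfolding unity_roots_def by (auto simp: power_0_left)

lemma unity_roots_norm: "N > 0 \<Longrightarrow> z \<in> unity_roots N \<Longrightarrow> cmod z = 1"
  unfolding unity_roots_def using power_eq_iff_eq_base[of N "cmod z" 1] by (simp flip: norm_power)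

lemma unity_roots_inverse: "z \<in> unity_roots N \<Longrightarrow> 1 / z \<in> unity_roots N"
  unfolding unity_roots_def by (simp add: power_divide)

lemma unity_roots_mult: "z \<in> unity_roots N \<Longrightarrow> w \<in> unity_roots N \<Longrightarrow> z * w \<in> unity_roots N"
  unfolding unity_roots_def by (simp add: power_mult_distrib)

lemma unity_roots_divide: "z \<in> unity_roots N \<Longrightarrow> w \<in> unity_roots N \<Longrightarrow> z / w \<in> unity_roots N"
  using unity_roots_mult[OF _ unity_roots_inverse, of z N w] by simp

text \<open>Rotation by a primitive root permutes the summands and multiplies the sum by a factor
  other than 1.\<close>

lemma sum_power_unity_roots:
  assumes "0 < k" "k < N"
  shows "(\<Sum>z\<in>unity_roots N. z ^ k) = 0"
proof -
  let ?w = "cis (2 * pi / real N)"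
  have w: "?w \<in> unity_roots N" unfolding unity_roots_def using assms by (simp add: DeMoivre)
  have bij: "(\<Sum>z\<in>unity_roots N. z ^ k) = (\<Sum>z\<in>unity_roots N. (?w * z) ^ k)"
    by (rule sum.reindex_bij_witness[of _ "\<lambda>z. ?w * z" "\<lambda>z. z / ?w"])
      (use w in \<open>auto intro: unity_roots_mult unity_roots_divide\<close>)
  have "?w ^ k \<noteq> 1"
  proof
    assume "?w ^ k = 1"
    then have "cis (2 * pi * real k / real N) = cis (2 * pi * real 0 / real N)"
      by (simp add: DeMoivre mult.commute)
    moreover have "inj_on (\<lambda>k. cis (2 * pi * real k / real N)) {..<N}"
      using bij_betw_roots_unity[of N] assms unfolding bij_betw_def by auto
    ultimately have "k = 0" using assms by (elim inj_onD) auto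
    then show False using assms by simp
  qed
  moreover have "(\<Sum>z\<in>unity_roots N. z ^ k) = ?w ^ k * (\<Sum>z\<in>unity_roots N. z ^ k)"
    by (subst bij) (simp add: power_mult_distrib sum_distrib_left)
  ultimately show ?thesis by (metis mult_cancel_right1)
qed

lemma sum_unity_roots_binomial:
  assumes "0 < k" "k + p < N"
  shows "(\<Sum>z\<in>unity_roots N. z ^ k * (1 + z) ^ p) = 0"
  using assms
proof (induction p arbitrary: k)
  case 0
  then show ?case using sum_power_unity_roots by simp
next
  case (Suc p)
  have "(\<Sum>z\<in>unity_roots N. z ^ k * (1 + z) ^ Suc p) =
    (\<Sum>z\<in>unity_roots N. z ^ k * (1 + z) ^ p) + (\<Sum>z\<in>unity_roots N. z ^ Suc k * (1 + z) ^ p)"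
    by (simp add: sum.distrib[symmetric] algebra_simps)
  then show ?case using Suc.IH[of k] Suc.IH[of "Suc k"] Suc.prems by simp
qed

lemma sum_unity_roots_binomial_0:
  assumes "p < N"
  shows "(\<Sum>z\<in>unity_roots N. (1 + z) ^ p) = of_nat N"
  using assms
proof (induction p)
  case 0
  then show ?case by (simp add: card_unity_roots)
next
  case (Suc p)
  have "(\<Sum>z\<in>unity_roots N. (1 + z) ^ Suc p) =
    (\<Sum>z\<in>unity_roots N. (1 + z) ^ p) + (\<Sum>z\<in>unity_roots N. z ^ 1 * (1 + z) ^ p)"
    by (simp add: sum.distrib[symmetric] algebra_simps)
  then show ?case using Suc sum_unity_roots_binomial[of 1 p N] by simp
qed

lemma sum_unity_roots_reciprocal:
  "(\<Sum>z\<in>unity_roots N. F (1 / z)) = (\<Sum>z\<in>unity_roots N. F z)"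
  by (rule sum.reindex_bij_witness[of _ "\<lambda>z. 1 / z" "\<lambda>z. 1 / z"]) (auto intro: unity_roots_inverse)

text \<open>This extracts the linear coefficient \<open>p\<close> of
  \<open>(1 + z) ^ p\<close>.\<close>

lemma sum_unity_roots_binomial_neg:
  assumes "p + 1 < N"
  shows "(\<Sum>z\<in>unity_roots N. (1 / z) * (1 + z) ^ p) = of_nat N * of_nat p"
  using assms
proof (induction p)
  case 0
  then show ?case using sum_unity_roots_reciprocal[of "\<lambda>z. z" N] sum_power_unity_roots[of 1 N] by simp
next
  case (Suc p)
  have "(1 / z) * (1 + z) ^ Suc p = (1 / z) * (1 + z) ^ p + (1 + z) ^ p" if "z \<in> unity_roots N" for z
    using unity_roots_nonzero[OF _ that] Suc.prems by (simp add: field_simps)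
  then have "(\<Sum>z\<in>unity_roots N. (1 / z) * (1 + z) ^ Suc p) =
    (\<Sum>z\<in>unity_roots N. (1 / z) * (1 + z) ^ p) + (\<Sum>z\<in>unity_roots N. (1 + z) ^ p)"
    by (simp add: sum.distrib[symmetric])
  then show ?case using Suc sum_unity_roots_binomial_0[of p N] by (simp add: algebra_simps)
qed

text \<open>Up to the factor \<open>N\<^sup>2\<close> this extracts the constant term of a Laurent polynomial in \<open>a\<close> and \<open>b\<close>
  of degree below \<open>N\<close>, where \<open>c\<close> stands for \<open>1 / (a b)\<close>.\<close>

definition torus_sum :: "nat \<Rightarrow> (complex \<Rightarrow> complex \<Rightarrow> complex \<Rightarrow> complex) \<Rightarrow> complex" where
  "torus_sum N G = (\<Sum>a\<in>unity_roots N. \<Sum>b\<in>unity_roots N. G a b (1 / (a * b)))"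

lemma torus_sum_cong:
  assumes "N > 0" "\<And>a b c. a \<in> unity_roots N \<Longrightarrow> b \<in> unity_roots N \<Longrightarrow> c \<in> unity_roots N \<Longrightarrow> a * b * c = 1 \<Longrightarrow> G a b c = H a b c"
  shows "torus_sum N G = torus_sum N H"
  unfolding torus_sum_def
proof (intro sum.cong refl)
  fix a b assume *: "a \<in> unity_roots N" "b \<in> unity_roots N"
  then have "a * b * (1 / (a * b)) = 1" using unity_roots_nonzero[OF assms(1)] by auto
  then show "G a b (1 / (a * b)) = H a b (1 / (a * b))"
    by (rule assms(2)[OF *(1,2) unity_roots_inverse[OF unity_roots_mult[OF *]]])
qed

lemma torus_sum_swap_bc:
  assumes "N > 0"
  shows "torus_sum N (\<lambda>a b c. G a c b) = torus_sum N G"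
  unfolding torus_sum_def
proof (rule sum.cong[OF refl])
  fix a assume a: "a \<in> unity_roots N"
  have "1 / (a * b) \<in> unity_roots N" "1 / (a * (1 / (a * b))) = b" if "b \<in> unity_roots N" for b
    using unity_roots_inverse[OF unity_roots_mult[OF a that]] unity_roots_nonzero[OF assms] a that by auto
  then show "(\<Sum>b\<in>unity_roots N. G a (1 / (a * b)) b) = (\<Sum>b\<in>unity_roots N. G a b (1 / (a * b)))"
    by (intro sum.reindex_bij_witness[of _ "\<lambda>b. 1 / (a * b)" "\<lambda>b. 1 / (a * b)"]) (simp_all only:)
qed

text \<open>The exchange of \<open>b\<close> and \<open>c\<close> conjugated by that of
  \<open>a\<close> and \<open>b\<close>, which is a change of the order of summation.\<close>

lemma torus_sum_swap_ac:
  assumes "N > 0"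
  shows "torus_sum N (\<lambda>a b c. G c b a) = torus_sum N G"
proof -
  have "torus_sum N (\<lambda>a b c. G c b a) = torus_sum N (\<lambda>a b c. G c a b)"
    unfolding torus_sum_def by (subst sum.swap) (simp add: mult.commute)
  also have "\<dots> = torus_sum N (\<lambda>a b c. G b a c)"
    using torus_sum_swap_bc[OF assms, of "\<lambda>a b c. G b a c"] by simp
  also have "\<dots> = torus_sum N G"
    unfolding torus_sum_def by (subst sum.swap) (simp add: mult.commute)
  finally show ?thesis .
qed

lemma torus_sum_add: "torus_sum N (\<lambda>a b c. G a b c + H a b c) = torus_sum N G + torus_sum N H"
  unfolding torus_sum_def by (simp add: sum.distrib)

lemma torus_sum_diff: "torus_sum N (\<lambda>a b c. G a b c - H a b c) = torus_sum N G - torus_sum N H"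
  unfolding torus_sum_def by (simp add: sum_subtractf)

lemma torus_sum_minus: "torus_sum N (\<lambda>a b c. - G a b c) = - torus_sum N G"
  unfolding torus_sum_def by (simp add: sum_negf)

lemma torus_sum_sum: "torus_sum N (\<lambda>a b c. \<Sum>j\<in>J. G j a b c) = (\<Sum>j\<in>J. torus_sum N (G j))"
proof -
  have "torus_sum N (\<lambda>a b c. \<Sum>j\<in>J. G j a b c) = (\<Sum>a\<in>unity_roots N. \<Sum>j\<in>J. \<Sum>b\<in>unity_roots N. G j a b (1 / (a * b)))"
    unfolding torus_sum_def by (intro sum.cong refl sum.swap)
  also have "\<dots> = (\<Sum>j\<in>J. torus_sum N (G j))"
    unfolding torus_sum_def by (rule sum.swap)
  finally show ?thesis .
qed

lemma torus_sum_antisym_bc: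
  assumes "N > 0" "\<And>a b c. G a c b = - G a b c"
  shows "torus_sum N G = 0"
proof -
  have "(\<lambda>a b c. G a c b) = (\<lambda>a b c. - G a b c)" by (intro ext) (rule assms(2))
  then show ?thesis using torus_sum_swap_bc[OF assms(1), of G] torus_sum_minus[of N G] by simp
qed

lemma torus_sum_antisym_ac:
  assumes "N > 0" "\<And>a b c. G c b a = - G a b c"
  shows "torus_sum N G = 0"
proof -
  have "(\<lambda>a b c. G c b a) = (\<lambda>a b c. - G a b c)" by (intro ext) (rule assms(2))
  then show ?thesis using torus_sum_swap_ac[OF assms(1), of G] torus_sum_minus[of N G] by simp
qed

text \<open>For \<open>s \<notin> {0, 4}\<close>, \<open>cheb m s\<close> is \<open>(l\<^sup>m - l'\<^sup>m) / (l - l')\<close> for the roots \<open>l\<close>, \<open>l'\<close> of \<open>l\<^sup>2 = s l - s\<close>.\<close>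

fun cheb :: "nat \<Rightarrow> 'a::comm_ring_1 \<Rightarrow> 'a" where
  "cheb 0 s = 0"
| "cheb (Suc 0) s = 1"
| "cheb (Suc (Suc m)) s = s * (cheb (Suc m) s - cheb m s)"

section \<open>An antisymmetric kernel solving the recursion\<close>

definition vand :: "complex \<Rightarrow> complex \<Rightarrow> complex \<Rightarrow> complex" where
  "vand a b c = (b - a) * (b - c) * (c - a)"

definition symb :: "complex \<Rightarrow> complex \<Rightarrow> complex \<Rightarrow> complex" where
  "symb a b c = (1 + a) * (1 + b) * (1 + c)"

lemma vand_swap: "vand a c b = - vand a b c" "vand c b a = - vand a b c"
  unfolding vand_def by (simp_all add: algebra_simps)

lemma symb_swap: "symb a c b = symb a b c" "symb c b a = symb a b c"
  unfolding symb_def by (simp_all add: algebra_simps)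

text \<open>Since \<open>a b c = 1\<close>, the factor \<open>1 + a c\<close> is \<open>y = 1 + 1 / b\<close>. The factor \<open>a (1 + c)\<close> is what
  makes the boundary terms of both geometric sums below antisymmetric.\<close>

definition kern :: "nat \<Rightarrow> nat \<Rightarrow> complex \<Rightarrow> complex \<Rightarrow> complex \<Rightarrow> complex" where
  "kern p q a b c = vand a b c * (a * (1 + c)) * (1 + a) ^ p * (1 + a * c) ^ q"

text \<open>Solutions of the recursions for \<^const>\<open>tree_count\<close> with flags \<open>(True, True)\<close>, \<open>(False, True)\<close>
  and \<open>(True, False)\<close>.\<close>

definition val_B :: "nat \<Rightarrow> nat \<Rightarrow> nat \<Rightarrow> nat \<Rightarrow> complex" where
  "val_B N m p q = torus_sum N (\<lambda>a b c. kern p q a b c *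
     (cheb (Suc m) (symb a b c) - (b + a * b + b * c + c) * cheb m (symb a b c)))"

definition val_R :: "nat \<Rightarrow> nat \<Rightarrow> nat \<Rightarrow> nat \<Rightarrow> complex" where
  "val_R N m p q = torus_sum N (\<lambda>a b c. kern (Suc p) q a b c * cheb m (symb a b c))"

definition val_L :: "nat \<Rightarrow> nat \<Rightarrow> nat \<Rightarrow> nat \<Rightarrow> complex" where
  "val_L N m p q = torus_sum N (\<lambda>a b c. kern p (Suc q) a b c * cheb m (symb a b c))"

lemma geometric_identity:
  fixes y :: complex
  assumes "q \<ge> 1" "u * (y - 1) = 1"
  shows "(\<Sum>j\<in>{1..<q}. y ^ j) = u * y ^ q - u * y"
  using assms(1)
proof (induction q rule: dec_induct)
  case base
  then show ?case by simp
next
  case (step q)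
  have "u * y ^ Suc q = u * (y - 1) * y ^ q + u * y ^ q" by (simp add: algebra_simps)
  then show ?case using step assms(2) by simp
qed

text \<open>On the torus \<open>1 / (y - 1)\<close> is the monomial \<open>b\<close>. The upper end
  of the geometric sum gives the right-hand side; the lower end gives \<open>?E\<close>, which is
  symmetric in \<open>b\<close> and \<open>c\<close> up to the sign of \<open>vand\<close>.\<close>

lemma sum_val_R:
  assumes N: "N > 0" and q: "q \<ge> 1"
  shows "(\<Sum>j\<in>{1..<q}. val_R N m p j) = torus_sum N (\<lambda>a b c. kern (Suc p) q a b c * (b * cheb m (symb a b c)))"
proof -
  let ?E = "\<lambda>a b c. vand a b c * (a * (1 + c)) * (1 + b) * (1 + a) ^ Suc p * cheb m (symb a b c)"
  have "(\<Sum>j\<in>{1..<q}. val_R N m p j) = torus_sum N (\<lambda>a b c. \<Sum>j\<in>{1..<q}. kern (Suc p) j a b c * cheb m (symb a b c))"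
    unfolding val_R_def torus_sum_sum ..
  also have "\<dots> = torus_sum N (\<lambda>a b c. kern (Suc p) q a b c * (b * cheb m (symb a b c)) - ?E a b c)"
  proof (rule torus_sum_cong[OF N])
    fix a b c :: complex assume 1: "a * b * c = 1"
    then have "b * ((1 + a * c) - 1) = 1" by (simp add: ac_simps)
    from geometric_identity[OF q this]
    have g: "(\<Sum>j\<in>{1..<q}. (1 + a * c) ^ j) = b * (1 + a * c) ^ q - (1 + b)"
      using 1 by (simp add: algebra_simps)
    have "(\<Sum>j\<in>{1..<q}. kern (Suc p) j a b c * cheb m (symb a b c))
      = vand a b c * (a * (1 + c)) * (1 + a) ^ Suc p * cheb m (symb a b c) * (\<Sum>j\<in>{1..<q}. (1 + a * c) ^ j)"
      unfolding kern_def sum_distrib_left by (intro sum.cong refl) (simp only: ac_simps)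
    then show "(\<Sum>j\<in>{1..<q}. kern (Suc p) j a b c * cheb m (symb a b c)) =
        kern (Suc p) q a b c * (b * cheb m (symb a b c)) - ?E a b c"
      unfolding g kern_def right_diff_distrib by (simp only: mult_ac)
  qed
  also have "\<dots> = torus_sum N (\<lambda>a b c. kern (Suc p) q a b c * (b * cheb m (symb a b c))) - torus_sum N ?E"
    by (rule torus_sum_diff)
  also have "torus_sum N ?E = 0"
  proof (rule torus_sum_antisym_bc[OF N])
    fix a b c show "?E a c b = - ?E a b c"
      unfolding vand_swap(1)[of a c b] symb_swap(1)[of a c b] mult_minus_left by (simp only: mult_ac)
  qed
  finally show ?thesis by simp
qed

lemma sum_val_L:
  assumes N: "N > 0" and p: "p \<ge> 1"
  shows "(\<Sum>j\<in>{1..<p}. val_L N m j q) = torus_sum N (\<lambda>a b c. kern p (Suc q) a b c * (b * c * cheb m (symb a b c)))"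
proof -
  \<comment> \<open>The lower end of the geometric sum, with its factor \<open>a * b * c\<close>
    already replaced by 1; both \<open>(1 + c) * (1 + a)\<close> and \<open>1 + a * c\<close> are
    symmetric in \<open>a\<close> and \<open>c\<close>.\<close>
  let ?E = "\<lambda>a b c. vand a b c * (1 + c) * (1 + a) * (1 + a * c) ^ Suc q * cheb m (symb a b c)"
  have "(\<Sum>j\<in>{1..<p}. val_L N m j q) = torus_sum N (\<lambda>a b c. \<Sum>j\<in>{1..<p}. kern j (Suc q) a b c * cheb m (symb a b c))"
    unfolding val_L_def torus_sum_sum ..
  also have "\<dots> = torus_sum N (\<lambda>a b c. kern p (Suc q) a b c * (b * c * cheb m (symb a b c)) - ?E a b c)"
  proof (rule torus_sum_cong[OF N])
    fix a b c :: complex assume 1: "a * b * c = 1"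
    then have "(b * c) * ((1 + a) - 1) = 1" by (simp add: ac_simps)
    from geometric_identity[OF p this]
    have g: "(\<Sum>j\<in>{1..<p}. (1 + a) ^ j) = b * c * (1 + a) ^ p - b * c * (1 + a)" .
    have "(\<Sum>j\<in>{1..<p}. kern j (Suc q) a b c * cheb m (symb a b c))
      = vand a b c * (a * (1 + c)) * (1 + a * c) ^ Suc q * cheb m (symb a b c) * (\<Sum>j\<in>{1..<p}. (1 + a) ^ j)"
      unfolding kern_def sum_distrib_left by (intro sum.cong refl) (simp only: ac_simps)
    also have "\<dots> = kern p (Suc q) a b c * (b * c * cheb m (symb a b c)) - (a * b * c) * ?E a b c"
      unfolding g kern_def right_diff_distrib by (simp only: mult_ac)
    finally show "(\<Sum>j\<in>{1..<p}. kern j (Suc q) a b c * cheb m (symb a b c)) =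
        kern p (Suc q) a b c * (b * c * cheb m (symb a b c)) - ?E a b c"
      unfolding 1 by simp
  qed
  also have "\<dots> = torus_sum N (\<lambda>a b c. kern p (Suc q) a b c * (b * c * cheb m (symb a b c))) - torus_sum N ?E"
    by (rule torus_sum_diff)
  also have "torus_sum N ?E = 0"
  proof (rule torus_sum_antisym_ac[OF N])
    fix a b c show "?E c b a = - ?E a b c"
      unfolding vand_swap(2)[of c b a] symb_swap(2)[of c b a] mult_minus_left by (simp only: ac_simps)
  qed
  finally show ?thesis by simp
qed

lemma symb_eq:
  assumes "a * b * c = (1::complex)"
  shows "symb a b c = (1 + a) + (1 + a * c) + (b + a * b + b * c + c)"
    and "symb a b c = (1 + a) * (1 + a * c) * (b + b * c)"
proof -
  have "symb a b c = 1 + a + b + c + a * b + a * c + b * c + a * b * c" unfolding symb_def by (simp add: algebra_simps)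
  then show "symb a b c = (1 + a) + (1 + a * c) + (b + a * b + b * c + c)" using assms by simp
  have "(1 + a) * (1 + a * c) * (b + b * c) = (1 + a) * (1 + c) * (b + a * b * c)" by (simp add: algebra_simps)
  then show "symb a b c = (1 + a) * (1 + a * c) * (b + b * c)" unfolding assms symb_def by (simp only: ac_simps)
qed

text \<open>With \<open>e = b + a * b + b * c + c\<close>, the right-hand side reduces via
  \<open>e = b * x + b * c * y\<close> to \<open>(x + y) * u - x * y * (b + b * c) * v\<close>. By
  the two forms of \<open>symb\<close> this is \<open>s * (u - v) - e * u\<close>, the recurrence of
  \<open>cheb\<close>.\<close>

lemma val_B_Suc:
  assumes N: "N > 0" and pq: "p \<ge> 1" "q \<ge> 1"
  shows "val_B N (Suc m) p q = val_B N m (Suc p) q + (\<Sum>j\<in>{1..<q}. val_R N m (Suc p) j) +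
     (val_B N m p (Suc q) + (\<Sum>j\<in>{1..<p}. val_L N m j (Suc q)))"
  unfolding val_B_def sum_val_R[OF N pq(2)] sum_val_L[OF N pq(1)] torus_sum_add[symmetric]
proof (rule torus_sum_cong[OF N])
  fix a b c :: complex assume 1: "a * b * c = 1"
  define x y u v k s where "x = 1 + a" and "y = 1 + a * c" and "u = cheb (Suc m) (symb a b c)"
    and "v = cheb m (symb a b c)" and "k = vand a b c * (a * (1 + c)) * (1 + a) ^ p * (1 + a * c) ^ q"
    and "s = symb a b c"
  define e where "e = b + a * b + b * c + c"
  have e: "e = b * x + b * c * y" unfolding e_def x_def y_def using 1 by (simp add: algebra_simps)
  have s: "s = x + y + e" "s = x * y * (b + b * c)" using symb_eq[OF 1] unfolding x_def y_def s_def e_def by auto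
  have k: "kern p q a b c = k" "kern (Suc p) q a b c = k * x" "kern p (Suc q) a b c = k * y"
     "kern (Suc (Suc p)) q a b c = k * x * x" "kern p (Suc (Suc q)) a b c = k * y * y"
    unfolding kern_def k_def x_def y_def by (simp_all only: power_Suc ac_simps)
  have c2: "cheb (Suc (Suc m)) (symb a b c) = s * (u - v)" unfolding u_def v_def s_def by simp
  have "s * (u - v) - e * u = x * (u - e * v) + x * x * (b * v) + (y * (u - e * v) + y * y * (b * c * v))"
  proof -
    have "s * (u - v) - e * u = (s - e) * u - s * v" by (simp add: algebra_simps)
    also have "\<dots> = (x + y) * u - x * y * (b + b * c) * v" using s by (metis add_diff_cancel_right')
    also have "\<dots> = x * (u - e * v) + x * x * (b * v) + (y * (u - e * v) + y * y * (b * c * v))"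
      unfolding e by (simp add: algebra_simps)
    finally show ?thesis .
  qed
  then have "k * (s * (u - v) - e * u) = k * (x * (u - e * v) + x * x * (b * v) + (y * (u - e * v) + y * y * (b * c * v)))"
    by (simp only:)
  also have "\<dots> = k * x * (u - e * v) + k * x * x * (b * v) + (k * y * (u - e * v) + k * y * y * (b * c * v))"
    by (simp only: distrib_left mult.assoc)
  finally show "kern p q a b c * (cheb (Suc (Suc m)) (symb a b c) - (b + a * b + b * c + c) * cheb (Suc m) (symb a b c)) =
    kern (Suc p) q a b c * (cheb (Suc m) (symb a b c) - (b + a * b + b * c + c) * cheb m (symb a b c)) +
    kern (Suc (Suc p)) q a b c * (b * cheb m (symb a b c)) +
    (kern p (Suc q) a b c * (cheb (Suc m) (symb a b c) - (b + a * b + b * c + c) * cheb m (symb a b c)) +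
     kern p (Suc (Suc q)) a b c * (b * c * cheb m (symb a b c)))"
    unfolding k c2 u_def[symmetric] v_def[symmetric] e_def[symmetric] .
qed

text \<open>With a false left flag the last left child is like the others, so the sum includes
  \<open>j = p\<close>. The choice of the coefficient in \<open>val_B\<close> as
  \<open>b * x + b * c * y\<close> makes all multiples of \<open>cheb m\<close> cancel.\<close>

lemma val_R_Suc:
  assumes N: "N > 0" and pq: "p \<ge> 1" "q \<ge> 1"
  shows "val_R N (Suc m) p q = val_B N m (Suc p) q + (\<Sum>j\<in>{1..<q}. val_R N m (Suc p) j) +
     (\<Sum>j\<in>{1..<Suc p}. val_L N m j q)"
proof -
  have p: "Suc p \<ge> 1" by simp
  show ?thesis
  unfolding val_B_def sum_val_R[OF N pq(2)] sum_val_L[OF N p] torus_sum_add[symmetric] val_R_def[of N "Suc m"]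
  proof (rule torus_sum_cong[OF N])
    fix a b c :: complex assume 1: "a * b * c = 1"
    have e: "b + a * b + b * c + c = b * (1 + a) + b * c * (1 + a * c)" using 1 by (simp add: algebra_simps)
    show "kern (Suc p) q a b c * cheb (Suc m) (symb a b c) =
      kern (Suc p) q a b c * (cheb (Suc m) (symb a b c) - (b + a * b + b * c + c) * cheb m (symb a b c)) +
      kern (Suc (Suc p)) q a b c * (b * cheb m (symb a b c)) +
      kern (Suc p) (Suc q) a b c * (b * c * cheb m (symb a b c))"
      unfolding e kern_def by (simp add: algebra_simps)
  qed
qed

lemma val_L_Suc:
  assumes N: "N > 0" and pq: "p \<ge> 1" "q \<ge> 1"
  shows "val_L N (Suc m) p q = (\<Sum>j\<in>{1..<Suc q}. val_R N m p j) + 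
     (val_B N m p (Suc q) + (\<Sum>j\<in>{1..<p}. val_L N m j (Suc q)))"
proof -
  have q: "Suc q \<ge> 1" by simp
  show ?thesis
  unfolding val_B_def sum_val_R[OF N q] sum_val_L[OF N pq(1)] torus_sum_add[symmetric] val_L_def[of N "Suc m"]
  proof (rule torus_sum_cong[OF N])
    fix a b c :: complex assume 1: "a * b * c = 1"
    have e: "b + a * b + b * c + c = b * (1 + a) + b * c * (1 + a * c)" using 1 by (simp add: algebra_simps)
    show "kern p (Suc q) a b c * cheb (Suc m) (symb a b c) =
      kern (Suc p) (Suc q) a b c * (b * cheb m (symb a b c)) +
      (kern p (Suc q) a b c * (cheb (Suc m) (symb a b c) - (b + a * b + b * c + c) * cheb m (symb a b c)) +
      kern p (Suc (Suc q)) a b c * (b * c * cheb m (symb a b c)))"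
      unfolding e kern_def by (simp add: algebra_simps)
  qed
qed

text \<open>Of the twelve monomials of \<open>vand a b c * (a * (1 + c))\<close> only
  \<open>b\<close> and \<open>1 / a\<close> contribute, with \<open>q\<close> and \<open>p\<close>.
  The other products contain a factor \<open>f k\<close> or \<open>g k\<close> with
  \<open>k \<in> {1,2,3}\<close>, which vanishes.\<close>

lemma torus_sum_kern:
  assumes "p + 3 < N" "q + 3 < N"
  shows "torus_sum N (kern p q) = of_nat (N * N * (p + q))"
proof -
  have N: "N > 0" using assms by simp
  let ?Z = "unity_roots N"
  define f g where "f k = (\<Sum>a\<in>?Z. a ^ k * (1 + a) ^ p)" and "g k = (\<Sum>b\<in>?Z. (1 / b) ^ k * (1 + 1 / b) ^ q)" for k :: nat
  define f' f'' g' where "f' = (\<Sum>a\<in>?Z. (1 / a) * (1 + a) ^ p)" and "f'' = (\<Sum>a\<in>?Z. (1 / a)^2 * (1 + a) ^ p)"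
    and "g' = (\<Sum>b\<in>?Z. b * (1 + 1 / b) ^ q)"
  have g_eq: "g k = (\<Sum>b\<in>?Z. b ^ k * (1 + b) ^ q)" for k
    unfolding g_def using sum_unity_roots_reciprocal[of "\<lambda>b. b ^ k * (1 + b) ^ q" N] .
  have f0: "f k = 0" "g k = 0" if "k \<in> {1,2,3}" for k
    unfolding f_def g_eq using sum_unity_roots_binomial[of k p N] sum_unity_roots_binomial[of k q N] that assms by auto
  have f1: "f 0 = of_nat N" "g 0 = of_nat N"
    unfolding f_def g_eq using sum_unity_roots_binomial_0[of p N] sum_unity_roots_binomial_0[of q N] assms by auto
  have f2: "f' = of_nat N * of_nat p" unfolding f'_def using sum_unity_roots_binomial_neg[of p N] assms by simp
  have g2: "g' = of_nat N * of_nat q"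
    unfolding g'_def using sum_unity_roots_binomial_neg[of q N] assms
      sum_unity_roots_reciprocal[of "\<lambda>b. (1 / b) * (1 + b) ^ q" N] by simp
  have prod: "(\<Sum>a\<in>?Z. \<Sum>b\<in>?Z. F a * G b) = (\<Sum>a\<in>?Z. F a) * (\<Sum>b\<in>?Z. G b)" for F G :: "complex \<Rightarrow> complex"
    by (simp add: sum_product)
  have "torus_sum N (kern p q) = (\<Sum>a\<in>?Z. \<Sum>b\<in>?Z.
      (a ^ 0 * (1 + a) ^ p) * (b * (1 + 1 / b) ^ q) + (a ^ 0 * (1 + a) ^ p) * ((1 / b) ^ 2 * (1 + 1 / b) ^ q)
      + (a ^ 3 * (1 + a) ^ p) * (b * (1 + 1 / b) ^ q) - (1 / a * (1 + a) ^ p) * ((1 / b) ^ 1 * (1 + 1 / b) ^ q)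
      - (a ^ 2 * (1 + a) ^ p) * ((1 / b) ^ 1 * (1 + 1 / b) ^ q) - (a ^ 2 * (1 + a) ^ p) * (b ^ 2 * (1 + 1 / b) ^ q)
      + (1 / a * (1 + a) ^ p) * ((1 / b) ^ 0 * (1 + 1 / b) ^ q) + (1 / a * (1 + a) ^ p) * ((1 / b) ^ 3 * (1 + 1 / b) ^ q)
      + (a ^ 2 * (1 + a) ^ p) * ((1 / b) ^ 0 * (1 + 1 / b) ^ q) - ((1 / a)^2 * (1 + a) ^ p) * ((1 / b) ^ 2 * (1 + 1 / b) ^ q)
      - (a ^ 1 * (1 + a) ^ p) * ((1 / b) ^ 2 * (1 + 1 / b) ^ q) - (a ^ 1 * (1 + a) ^ p) * (b * (1 + 1 / b) ^ q))"
    unfolding torus_sum_def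
  proof (intro sum.cong refl)
    fix a b assume ab: "a \<in> ?Z" "b \<in> ?Z"
    have nz: "a \<noteq> 0" "b \<noteq> 0" using unity_roots_nonzero[OF N] ab by auto
    define i j where "i = 1 / a" and "j = 1 / b"
    have ij: "a * i = 1" "b * j = 1" using nz unfolding i_def j_def by auto
    have c: "1 / (a * b) = i * j" unfolding i_def j_def by simp
    have aj: "1 + a * (i * j) = 1 + j" using ij by (simp add: mult.assoc[symmetric])
    have e: "vand a b (i * j) * (a * (1 + i * j)) = 
      b + j^2 + a^3 * b - i * j - a^2 * j - a^2 * b^2 + i + i * j^3 + a^2 - i^2 * j^2 - a * j^2 - a * b"
      unfolding vand_def using ij by algebra
    have "kern p q a b (i * j) = (vand a b (i * j) * (a * (1 + i * j))) * ((1 + a) ^ p * (1 + j) ^ q)"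
      unfolding kern_def aj by (simp only: mult.assoc)
    then show "kern p q a b (1 / (a * b)) =
      (a ^ 0 * (1 + a) ^ p) * (b * (1 + 1 / b) ^ q) + (a ^ 0 * (1 + a) ^ p) * ((1 / b) ^ 2 * (1 + 1 / b) ^ q)
      + (a ^ 3 * (1 + a) ^ p) * (b * (1 + 1 / b) ^ q) - (1 / a * (1 + a) ^ p) * ((1 / b) ^ 1 * (1 + 1 / b) ^ q)
      - (a ^ 2 * (1 + a) ^ p) * ((1 / b) ^ 1 * (1 + 1 / b) ^ q) - (a ^ 2 * (1 + a) ^ p) * (b ^ 2 * (1 + 1 / b) ^ q)
      + (1 / a * (1 + a) ^ p) * ((1 / b) ^ 0 * (1 + 1 / b) ^ q) + (1 / a * (1 + a) ^ p) * ((1 / b) ^ 3 * (1 + 1 / b) ^ q)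
      + (a ^ 2 * (1 + a) ^ p) * ((1 / b) ^ 0 * (1 + 1 / b) ^ q) - ((1 / a)^2 * (1 + a) ^ p) * ((1 / b) ^ 2 * (1 + 1 / b) ^ q)
      - (a ^ 1 * (1 + a) ^ p) * ((1 / b) ^ 2 * (1 + 1 / b) ^ q) - (a ^ 1 * (1 + a) ^ p) * (b * (1 + 1 / b) ^ q)"
      unfolding c i_def[symmetric] j_def[symmetric] e by (simp add: algebra_simps)
  qed
  also have "\<dots> = f 0 * g' + f 0 * g 2 + f 3 * g' - f' * g 1 - f 2 * g 1 - f 2 * (\<Sum>b\<in>?Z. b ^ 2 * (1 + 1 / b) ^ q)
      + f' * g 0 + f' * g 3 + f 2 * g 0 - f'' * g 2 - f 1 * g 2 - f 1 * g'"
    unfolding sum.distrib sum_subtractf prod f_def g_def f'_def f''_def g'_def ..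
  also have "\<dots> = of_nat N * g' + f' * of_nat N"
    using f0 f1 by simp
  finally show ?thesis unfolding f2 g2 by (simp add: algebra_simps)
qed


section \<open>Comparison of the averages with the tree count\<close>

lemma sum_atLeastAtMost_last:
  fixes F :: "nat \<Rightarrow> bool \<Rightarrow> nat"
  assumes "q \<ge> 1"
  shows "(\<Sum>j\<in>{1..q}. F j (r \<and> j = q)) = F q r + (\<Sum>j\<in>{1..<q}. F j False)"
proof -
  have "{1..q} = insert q {1..<q}" using assms by auto
  moreover have "(\<Sum>j\<in>{1..<q}. F j (r \<and> j = q)) = (\<Sum>j\<in>{1..<q}. F j False)"
    by (intro sum.cong) auto
  ultimately show ?thesis by simp
qed

lemma tree_count_TT:
  assumes "p \<ge> 1" "q \<ge> 1"
  shows "tree_count (Suc m) p q True True =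
    tree_count m (Suc p) q True True + (\<Sum>j\<in>{1..<q}. tree_count m (Suc p) j False True) +
    (tree_count m p (Suc q) True True + (\<Sum>j\<in>{1..<p}. tree_count m j (Suc q) True False))"
  using sum_atLeastAtMost_last[OF assms(2), of "\<lambda>j b. tree_count m (Suc p) j b True" True]
    sum_atLeastAtMost_last[OF assms(1), of "\<lambda>j b. tree_count m j (Suc q) True b" True] by simp

lemma tree_count_FT:
  assumes "q \<ge> 1"
  shows "tree_count (Suc m) p q False True =
    tree_count m (Suc p) q True True + (\<Sum>j\<in>{1..<q}. tree_count m (Suc p) j False True) +
    (\<Sum>j\<in>{1..<Suc p}. tree_count m j q True False)"
  using sum_atLeastAtMost_last[OF assms, of "\<lambda>j b. tree_count m (Suc p) j b True" True]
  by (simp add: atLeastLessThanSuc_atLeastAtMost)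

lemma tree_count_TF:
  assumes "p \<ge> 1"
  shows "tree_count (Suc m) p q True False = (\<Sum>j\<in>{1..<Suc q}. tree_count m p j False True) +
    (tree_count m p (Suc q) True True + (\<Sum>j\<in>{1..<p}. tree_count m j (Suc q) True False))"
  using sum_atLeastAtMost_last[OF assms, of "\<lambda>j b. tree_count m j (Suc q) True b" True]
  by (simp add: atLeastLessThanSuc_atLeastAtMost)

lemma val_1:
  assumes "p + 4 < N" "q + 4 < N"
  shows "val_R N 1 p q = of_nat (N * N * (p + q + 1))" "val_L N 1 p q = of_nat (N * N * (p + q + 1))"
    "val_B N 1 p q = of_nat (N * N * (2 * (p + q + 1)))"
proof -
  have N: "N > 0" using assms by simp
  have k: "torus_sum N (kern (Suc p) q) = of_nat (N * N * (p + q + 1))"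
    "torus_sum N (kern p (Suc q)) = of_nat (N * N * (p + q + 1))"
    using torus_sum_kern[of "Suc p" N q] torus_sum_kern[of p N "Suc q"] assms by simp_all
  show "val_R N 1 p q = of_nat (N * N * (p + q + 1))" "val_L N 1 p q = of_nat (N * N * (p + q + 1))"
    unfolding val_R_def val_L_def using k by simp_all
  have "val_B N 1 p q = torus_sum N (\<lambda>a b c. kern (Suc p) q a b c + kern p (Suc q) a b c)"
    unfolding val_B_def
  proof (rule torus_sum_cong[OF N])
    fix a b c :: complex assume 1: "a * b * c = 1"
    have e: "cheb (Suc 1) (symb a b c) - (b + a * b + b * c + c) * cheb 1 (symb a b c) = (1 + a) + (1 + a * c)"
      using symb_eq(1)[OF 1] by simp
    show "kern p q a b c * (cheb (Suc 1) (symb a b c) - (b + a * b + b * c + c) * cheb 1 (symb a b c)) =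
         kern (Suc p) q a b c + kern p (Suc q) a b c"
      unfolding e kern_def distrib_left[of _ "1 + a" "1 + a * c"] by (simp only: power_Suc mult_ac)
  qed
  then show "val_B N 1 p q = of_nat (N * N * (2 * (p + q + 1)))"
    unfolding torus_sum_add k by simp
qed

text \<open>The induction starts at depth 1: at depth 0 the count is 1 but \<open>val_B\<close> is
  \<open>N * N * (p + q)\<close>, so no constant would do. At depth 1 the count is
  \<open>p + q\<close>, and 4 absorbs \<open>2 * (p + q + 1)\<close>. Each level raises
  \<open>p\<close> and \<open>q\<close> by at most one, hence the \<open>m\<close> in the bounds on
  \<open>N\<close>.\<close>

lemma val_le_tree_count:
  assumes "p \<ge> 1" "q \<ge> 1" "p + m + 4 < N" "q + m + 4 < N"
  shows "Re (val_B N (Suc m) p q) \<le> 4 * real (N * N) * real (tree_count (Suc m) p q True True) \<and>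
    Re (val_R N (Suc m) p q) \<le> 4 * real (N * N) * real (tree_count (Suc m) p q False True) \<and>
    Re (val_L N (Suc m) p q) \<le> 4 * real (N * N) * real (tree_count (Suc m) p q True False)"
  using assms
proof (induction m arbitrary: p q)
  case 0
  have "real (N * N) * (2 * (real p + real q + 1)) \<le> real (N * N) * (4 * (real p + real q))"
    using 0 by (intro mult_left_mono) auto
  moreover have "real (N * N) * (real p + real q + 1) \<le> real (N * N) * (4 * (real p + real q))"
    using 0 by (intro mult_left_mono) auto
  ultimately show ?case using val_1[of p N q] 0 by (simp add: algebra_simps)
next
  case (Suc m)
  let ?C = "4 * real (N * N)"
  have N: "N > 0" using Suc.prems by simp
  have B: "Re (val_B N (Suc m) i j) \<le> ?C * real (tree_count (Suc m) i j True True)"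
    and R: "Re (val_R N (Suc m) i j) \<le> ?C * real (tree_count (Suc m) i j False True)"
    and L: "Re (val_L N (Suc m) i j) \<le> ?C * real (tree_count (Suc m) i j True False)"
    if "1 \<le> i" "i \<le> Suc p" "1 \<le> j" "j \<le> Suc q" for i j
    using Suc.IH[of i j] Suc.prems that by auto
  have sR: "Re (\<Sum>j\<in>{1..<q'}. val_R N (Suc m) i j) \<le> ?C * real (\<Sum>j\<in>{1..<q'}. tree_count (Suc m) i j False True)"
    if "1 \<le> i" "i \<le> Suc p" "q' \<le> Suc q" for i q'
    unfolding Re_sum of_nat_sum sum_distrib_left using that by (intro sum_mono R) auto
  have sL: "Re (\<Sum>j\<in>{1..<p'}. val_L N (Suc m) j i) \<le> ?C * real (\<Sum>j\<in>{1..<p'}. tree_count (Suc m) j i True False)"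
    if "1 \<le> i" "i \<le> Suc q" "p' \<le> Suc p" for i p'
    unfolding Re_sum of_nat_sum sum_distrib_left using that by (intro sum_mono L) auto
  have pq: "p \<ge> 1" "q \<ge> 1" using Suc.prems by auto
  have "Re (val_B N (Suc (Suc m)) p q) \<le> ?C * real (tree_count (Suc (Suc m)) p q True True)"
    unfolding val_B_Suc[OF N pq] tree_count_TT[OF pq] plus_complex.sel of_nat_add distrib_left
    using pq by (intro add_mono B sR sL) auto
  moreover have "Re (val_R N (Suc (Suc m)) p q) \<le> ?C * real (tree_count (Suc (Suc m)) p q False True)"
    unfolding val_R_Suc[OF N pq] tree_count_FT[OF pq(2)] plus_complex.sel of_nat_add distrib_left
    using pq by (intro add_mono B sR sL) auto
  moreover have "Re (val_L N (Suc (Suc m)) p q) \<le> ?C * real (tree_count (Suc (Suc m)) p q True False)"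
    unfolding val_L_Suc[OF N pq] tree_count_TF[OF pq(1)] plus_complex.sel of_nat_add distrib_left
    using pq by (intro add_mono B sR sL) auto
  ultimately show ?case by blast
qed

text \<open>At \<open>p = q = 1\<close> the kernel is \<open>vand\<close> times
  \<open>a^2 * c\<close> times the symmetric \<open>symb\<close>. The part with
  \<open>cheb m\<close> splits into a term antisymmetric in \<open>b\<close>, \<open>c\<close> and
  one antisymmetric in \<open>a\<close>, \<open>c\<close>. In the rest, the alternating sum of the
  six permuted monomials is \<open>- vand\<close>.\<close>

lemma val_B_1_1:
  assumes N: "N > 0"
  shows "6 * val_B N m 1 1 = torus_sum N (\<lambda>a b c. - (vand a b c)\<^sup>2 * (symb a b c * cheb (Suc m) (symb a b c)))"
proof -
  define X where "X a b c = symb a b c * cheb (Suc m) (symb a b c)" for a b c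
  define Y where "Y a b c = symb a b c * cheb m (symb a b c)" for a b c
  have X: "X a c b = X a b c" "X c b a = X a b c" and Y: "Y a c b = Y a b c" "Y c b a = Y a b c" for a b c
    unfolding X_def Y_def symb_swap(1)[of a c b] symb_swap(2)[of c b a] by auto
  define I where "I g = torus_sum N (\<lambda>a b c. vand a b c * g a b c * X a b c)" for g :: "complex \<Rightarrow> complex \<Rightarrow> complex \<Rightarrow> complex"
  have swap: "I (\<lambda>a b c. g a c b) = - I g" "I (\<lambda>a b c. g c b a) = - I g" for g
  proof -
    have "I g = torus_sum N (\<lambda>a b c. vand a c b * g a c b * X a c b)"
      unfolding I_def by (rule torus_sum_swap_bc[OF N, symmetric])
    also have "\<dots> = torus_sum N (\<lambda>a b c. - (vand a b c * g a c b * X a b c))"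
      by (intro torus_sum_cong[OF N]) (metis vand_swap(1) X(1) mult_minus_left)
    finally show "I (\<lambda>a b c. g a c b) = - I g" unfolding torus_sum_minus by (simp add: I_def)
    have "I g = torus_sum N (\<lambda>a b c. vand c b a * g c b a * X c b a)"
      unfolding I_def by (rule torus_sum_swap_ac[OF N, symmetric])
    also have "\<dots> = torus_sum N (\<lambda>a b c. - (vand a b c * g c b a * X a b c))"
      by (intro torus_sum_cong[OF N]) (metis vand_swap(2) X(2) mult_minus_left)
    finally show "I (\<lambda>a b c. g c b a) = - I g" unfolding torus_sum_minus by (simp add: I_def)
  qed
  have "val_B N m 1 1 = torus_sum N (\<lambda>a b c. vand a b c * (a^2 * c) * X a b c
     - (vand a b c * (a + a^2) * Y a b c + vand a b c * (a * c + (a * c)^2) * Y a b c))"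
    unfolding val_B_def
  proof (rule torus_sum_cong[OF N])
    fix a b c :: complex assume 1: "a * b * c = 1"
    have "1 + a * c = a * c * (1 + b)" using 1 by (simp add: algebra_simps)
    then have k: "kern 1 1 a b c = vand a b c * (a^2 * c) * symb a b c"
      unfolding kern_def symb_def by (simp add: power2_eq_square mult_ac)
    have "a^2 * c * (b + a * b + b * c + c) = (a * b * c) * a + (a * b * c) * a^2 + (a * b * c) * (a * c) + (a * c)^2"
      by (simp add: power2_eq_square algebra_simps)
    then have e: "a^2 * c * (b + a * b + b * c + c) = a + a^2 + (a * c + (a * c)^2)" using 1 by simp
    have "kern 1 1 a b c * (cheb (Suc m) (symb a b c) - (b + a * b + b * c + c) * cheb m (symb a b c)) =
      vand a b c * (a^2 * c) * X a b c - vand a b c * (a^2 * c * (b + a * b + b * c + c)) * Y a b c"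
      unfolding k X_def Y_def right_diff_distrib by (simp only: mult_ac)
    then show "kern 1 1 a b c * (cheb (Suc m) (symb a b c) - (b + a * b + b * c + c) * cheb m (symb a b c)) =
      vand a b c * (a^2 * c) * X a b c
     - (vand a b c * (a + a^2) * Y a b c + vand a b c * (a * c + (a * c)^2) * Y a b c)"
      unfolding e by (simp only: distrib_left distrib_right)
  qed
  also have "\<dots> = I (\<lambda>a b c. a^2 * c) - (torus_sum N (\<lambda>a b c. vand a b c * (a + a^2) * Y a b c) +
      torus_sum N (\<lambda>a b c. vand a b c * (a * c + (a * c)^2) * Y a b c))"
    unfolding torus_sum_diff torus_sum_add I_def ..
  also have "torus_sum N (\<lambda>a b c. vand a b c * (a + a^2) * Y a b c) = 0"
    by (rule torus_sum_antisym_bc[OF N]) (metis vand_swap(1) Y(1) mult_minus_left)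
  also have "torus_sum N (\<lambda>a b c. vand a b c * (a * c + (a * c)^2) * Y a b c) = 0"
    by (rule torus_sum_antisym_ac[OF N]) (metis vand_swap(2) Y(2) mult_minus_left mult.commute)
  finally have v: "val_B N m 1 1 = I (\<lambda>a b c. a^2 * c)" by simp
  have sw: "I (\<lambda>a b c. a^2 * b) = - I (\<lambda>a b c. a^2 * c)" "I (\<lambda>a b c. c^2 * a) = - I (\<lambda>a b c. a^2 * c)"
    "I (\<lambda>a b c. c^2 * b) = - I (\<lambda>a b c. a^2 * b)" "I (\<lambda>a b c. b^2 * a) = - I (\<lambda>a b c. c^2 * a)"
    "I (\<lambda>a b c. b^2 * c) = - I (\<lambda>a b c. c^2 * b)"
    using swap(1)[of "\<lambda>a b c. a^2 * c"] swap(2)[of "\<lambda>a b c. a^2 * c"] swap(2)[of "\<lambda>a b c. a^2 * b"]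
      swap(1)[of "\<lambda>a b c. c^2 * a"] swap(1)[of "\<lambda>a b c. c^2 * b"] by auto
  have "6 * I (\<lambda>a b c. a^2 * c) = I (\<lambda>a b c. a^2 * c) - I (\<lambda>a b c. a^2 * b) - I (\<lambda>a b c. c^2 * a)
     + I (\<lambda>a b c. c^2 * b) + I (\<lambda>a b c. b^2 * a) - I (\<lambda>a b c. b^2 * c)"
    using sw by simp
  also have "\<dots> = torus_sum N (\<lambda>a b c. vand a b c * (a^2 * c) * X a b c - vand a b c * (a^2 * b) * X a b c
      - vand a b c * (c^2 * a) * X a b c + vand a b c * (c^2 * b) * X a b c
      + vand a b c * (b^2 * a) * X a b c - vand a b c * (b^2 * c) * X a b c)"
    unfolding I_def torus_sum_add torus_sum_diff ..
  also have "\<dots> = torus_sum N (\<lambda>a b c. - (vand a b c)\<^sup>2 * X a b c)"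
  proof (rule torus_sum_cong[OF N])
    fix a b c :: complex
    have e: "a^2 * c - a^2 * b - c^2 * a + c^2 * b + b^2 * a - b^2 * c = - vand a b c"
      unfolding vand_def by algebra
    have "vand a b c * (a^2 * c) * X a b c - vand a b c * (a^2 * b) * X a b c
      - vand a b c * (c^2 * a) * X a b c + vand a b c * (c^2 * b) * X a b c
      + vand a b c * (b^2 * a) * X a b c - vand a b c * (b^2 * c) * X a b c
      = vand a b c * (a^2 * c - a^2 * b - c^2 * a + c^2 * b + b^2 * a - b^2 * c) * X a b c"
      by (simp only: distrib_left distrib_right right_diff_distrib left_diff_distrib)
    then show "vand a b c * (a^2 * c) * X a b c - vand a b c * (a^2 * b) * X a b c
      - vand a b c * (c^2 * a) * X a b c + vand a b c * (c^2 * b) * X a b c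
      + vand a b c * (b^2 * a) * X a b c - vand a b c * (b^2 * c) * X a b c = - (vand a b c)\<^sup>2 * X a b c"
      unfolding e by (simp add: power2_eq_square)
  qed
  finally show ?thesis unfolding v X_def .
qed

section \<open>Growth of the polynomials\<close>

lemma cheb_of_real: "cheb m (complex_of_real s) = complex_of_real (cheb m s)"
  by (induction m s rule: cheb.induct) auto

text \<open>Successive quotients evolve by \<open>r \<mapsto> s * (1 - 1 / r)\<close>, which is
  increasing for positive r and by the last hypothesis does not send \<open>\<rho>\<close> below
  itself.\<close>

lemma cheb_growth:
  assumes "0 < \<rho>" "0 \<le> s" "\<rho>\<^sup>2 \<le> s * (\<rho> - 1)"
  shows "0 \<le> cheb m s \<and> \<rho> * cheb m s \<le> cheb (Suc m) (s :: real)"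
proof (induction m)
  case 0
  then show ?case by simp
next
  case (Suc m)
  then have 0: "0 \<le> cheb (Suc m) s" using assms(1) by (smt (verit) mult_nonneg_nonneg)
  have "\<rho> * (\<rho> * cheb (Suc m) s) = \<rho>\<^sup>2 * cheb (Suc m) s" by (simp add: power2_eq_square)
  also have "\<dots> \<le> s * (\<rho> - 1) * cheb (Suc m) s" using assms(3) 0 by (intro mult_right_mono)
  also have "\<dots> = s * (\<rho> * cheb (Suc m) s - cheb (Suc m) s)" by (simp add: algebra_simps)
  also have "\<dots> \<le> s * (\<rho> * cheb (Suc m) s - \<rho> * cheb m s)" using Suc assms(2) by (intro mult_left_mono) auto
  also have "\<dots> = \<rho> * cheb (Suc (Suc m)) s" by (simp add: algebra_simps)
  finally have "\<rho> * cheb (Suc m) s \<le> cheb (Suc (Suc m)) s" using assms(1) by simp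
  then show ?case using 0 by simp
qed

lemma cheb_ge_power:
  assumes "0 < \<rho>" "0 \<le> s" "\<rho>\<^sup>2 \<le> s * (\<rho> - 1)"
  shows "\<rho> ^ m \<le> cheb (Suc m) (s :: real)"
proof (induction m)
  case 0
  then show ?case by simp
next
  case (Suc m)
  have "\<rho> ^ Suc m \<le> \<rho> * cheb (Suc m) s" using Suc assms(1) by simp
  then show ?case using cheb_growth[OF assms, of "Suc m"] by linarith
qed

lemma cheb_bound:
  assumes "\<bar>s\<bar> \<le> 4"
  shows "\<bar>cheb m s\<bar> \<le> (5 :: real) ^ m \<and> \<bar>cheb (Suc m) s\<bar> \<le> 5 ^ Suc m"
proof (induction m)
  case 0
  then show ?case by simp
next
  case (Suc m)
  have "\<bar>cheb (Suc (Suc m)) s\<bar> = \<bar>s\<bar> * \<bar>cheb (Suc m) s - cheb m s\<bar>" by (simp add: abs_mult)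
  also have "\<dots> \<le> 4 * (5 ^ Suc m + 5 ^ m)" using assms Suc by (intro mult_mono) auto
  also have "\<dots> \<le> 5 ^ Suc (Suc m)" by simp
  finally show ?case using Suc by simp
qed

section \<open>Asymptotics\<close>

lemma cnj_unity_root:
  assumes "N > 0" "a \<in> unity_roots N" "a * w = 1"
  shows "cnj a = w"
proof -
  have "a * cnj a = 1"
    using complex_norm_square[of a] unity_roots_norm[OF assms(1,2)] by simp
  then have "cnj a * (a * w) = w" by (metis mult.assoc mult.commute mult_1)
  then show ?thesis using assms(3) by simp
qed

text \<open>Conjugation inverts each variable, so \<open>cnj a = b * c\<close> and likewise for the
  others; this makes \<open>symb\<close> real and \<open>vand\<close> purely imaginary.\<close>

lemma torus_point:
  assumes N: "N > 0" and Z: "a \<in> unity_roots N" "b \<in> unity_roots N" "c \<in> unity_roots N" and 1: "a * b * c = 1"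
  shows "symb a b c = complex_of_real (Re (symb a b c))"
    and "- (vand a b c)\<^sup>2 = complex_of_real ((cmod (vand a b c))\<^sup>2)"
    and "Re (symb a b c) = 2 + 2 * (Re a + Re b + Re c)"
    and "- 4 \<le> Re (symb a b c)" and "(cmod (vand a b c))\<^sup>2 \<le> 64"
proof -
  have cnj: "cnj a = b * c" "cnj b = a * c" "cnj c = a * b"
    using cnj_unity_root[OF N] Z 1 by (simp_all add: ac_simps)
  have s: "symb a b c = 2 + (a + cnj a) + (b + cnj b) + (c + cnj c)"
    unfolding symb_def cnj using 1 by (simp add: algebra_simps)
  then show sr: "symb a b c = complex_of_real (Re (symb a b c))"
    by (simp add: complex_eq_iff)
  show re: "Re (symb a b c) = 2 + 2 * (Re a + Re b + Re c)"
    unfolding s by simp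
  have "\<bar>Re a\<bar> \<le> 1" "\<bar>Re b\<bar> \<le> 1" "\<bar>Re c\<bar> \<le> 1"
    using abs_Re_le_cmod[of a] abs_Re_le_cmod[of b] abs_Re_le_cmod[of c] unity_roots_norm[OF N] Z by auto
  then show "- 4 \<le> Re (symb a b c)" unfolding re distrib_left by linarith
  have "cnj (vand a b c) = (a * b * c) * ((a - b) * (c - b) * (a - c))"
    unfolding vand_def complex_cnj_mult complex_cnj_diff cnj using 1 by algebra
  also have "\<dots> = - vand a b c" unfolding 1 vand_def by (simp add: algebra_simps)
  finally have "complex_of_real ((cmod (vand a b c))\<^sup>2) = vand a b c * (- vand a b c)"
    unfolding complex_norm_square by simp
  then show "- (vand a b c)\<^sup>2 = complex_of_real ((cmod (vand a b c))\<^sup>2)" by (simp add: power2_eq_square)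
  have le2: "cmod (x - y) \<le> 2" if "x \<in> unity_roots N" "y \<in> unity_roots N" for x y
    using norm_triangle_ineq4[of x y] unity_roots_norm[OF N] that by simp
  have "cmod (vand a b c) \<le> 2 * 2 * 2"
    unfolding vand_def norm_mult using le2 Z by (intro mult_mono) auto
  then have "(cmod (vand a b c))\<^sup>2 \<le> 8\<^sup>2" by (intro power_mono) auto
  then show "(cmod (vand a b c))\<^sup>2 \<le> 64" by simp
qed

definition weight :: "nat \<Rightarrow> complex \<Rightarrow> complex \<Rightarrow> real" where
  "weight m a b = (let c = 1 / (a * b); s = Re (symb a b c) in (cmod (vand a b c))\<^sup>2 * (s * cheb (Suc m) s))"

lemma val_B_weight:
  assumes N: "N > 0"
  shows "6 * Re (val_B N m 1 1) = (\<Sum>(a, b)\<in>unity_roots N \<times> unity_roots N. weight m a b)"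
proof -
  have "6 * val_B N m 1 1 = torus_sum N (\<lambda>a b c. complex_of_real (weight m a b))"
    unfolding val_B_1_1[OF N]
  proof (rule torus_sum_cong[OF N])
    fix a b c assume Z: "a \<in> unity_roots N" "b \<in> unity_roots N" "c \<in> unity_roots N" and 1: "a * b * c = 1"
    have c: "c = 1 / (a * b)" using 1 by (metis mult_zero_left nonzero_mult_div_cancel_left zero_neq_one)
    show "- (vand a b c)\<^sup>2 * (symb a b c * cheb (Suc m) (symb a b c)) = complex_of_real (weight m a b)"
      unfolding weight_def Let_def c[symmetric] torus_point(2)[OF N Z 1] of_real_mult
      by (metis torus_point(1)[OF N Z 1] cheb_of_real)
  qed
  also have "\<dots> = complex_of_real (\<Sum>(a, b)\<in>unity_roots N \<times> unity_roots N. weight m a b)"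
    unfolding torus_sum_def by (simp add: sum.cartesian_product case_prod_unfold)
  finally have "Re (6 * val_B N m 1 1) = (\<Sum>(a, b)\<in>unity_roots N \<times> unity_roots N. weight m a b)"
    by (metis Re_complex_of_real)
  then show ?thesis by simp
qed

text \<open>Up to \<open>s = 4\<close> the crude bounds multiply to 64 * 4; beyond it the weight is
  nonnegative.\<close>

lemma weight_ge:
  assumes N: "N > 0" and Z: "a \<in> unity_roots N" "b \<in> unity_roots N"
  shows "weight m a b \<ge> - (256 * 5 ^ Suc m)"
proof -
  define c where "c = 1 / (a * b)"
  define s where "s = Re (symb a b c)"
  have c: "c \<in> unity_roots N" unfolding c_def by (intro unity_roots_inverse unity_roots_mult Z)
  have 1: "a * b * c = 1" unfolding c_def using unity_roots_nonzero[OF N] Z by auto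
  note tp = torus_point[OF N Z c 1, folded s_def]
  have w: "weight m a b = (cmod (vand a b c))\<^sup>2 * (s * cheb (Suc m) s)"
    unfolding weight_def Let_def c_def[symmetric] s_def[symmetric] ..
  show ?thesis
  proof (cases "s \<le> 4")
    case True
    then have s4: "\<bar>s\<bar> \<le> 4" using tp(4) by simp
    have "\<bar>weight m a b\<bar> = (cmod (vand a b c))\<^sup>2 * (\<bar>s\<bar> * \<bar>cheb (Suc m) s\<bar>)" unfolding w by (simp add: abs_mult)
    also have "\<dots> \<le> 64 * (4 * 5 ^ Suc m)"
      using tp(5) s4 cheb_bound[OF s4, of m] by (intro mult_mono) auto
    finally show ?thesis by linarith
  next
    case False
    \<comment> \<open>The rate 2 is the double root of \<open>l^2 = s * l - s\<close> at
      \<open>s = 4\<close>.\<close>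
    then have "0 \<le> cheb (Suc m) s" using cheb_growth[of 2 s "Suc m"] by simp
    then have "0 \<le> weight m a b" unfolding w using False by simp
    moreover have "0 \<le> 256 * (5::real) ^ Suc m" by simp
    ultimately show ?thesis by linarith
  qed
qed

lemma sin_ge_half:
  fixes x :: real
  assumes "0 \<le> x" "x \<le> 1"
  shows "x / 2 \<le> sin x"
proof -
  have "\<bar>sin x - x\<bar> \<le> x ^ 3 / 6"
    using Maclaurin_sin_bound[of x 3] assms by (simp add: sin_coeff_def numeral_eq_Suc divide_simps mult.commute)
  moreover have "x ^ 3 \<le> x" using assms power_decreasing[of 1 3 x] by simp
  ultimately show ?thesis using assms by linarith
qed

text \<open>The chord has length \<open>2 * sin (\<bar>u - v\<bar> / 2)\<close>.\<close>

lemma cmod_cis_diff_ge: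
  assumes "0 \<le> e" "2 * e \<le> \<bar>u - v\<bar>" "\<bar>u - v\<bar> \<le> 2"
  shows "e \<le> cmod (cis u - cis v)"
proof (rule power2_le_imp_le)
  define x where "x = \<bar>u - v\<bar> / 2"
  have x: "e \<le> x" "0 \<le> x" "x \<le> 1" using assms unfolding x_def by auto
  have "(cmod (cis u - cis v))\<^sup>2 = (cos u - cos v)\<^sup>2 + (sin u - sin v)\<^sup>2"
    unfolding cmod_power2 by simp
  also have "\<dots> = ((cos u)\<^sup>2 + (sin u)\<^sup>2) + ((cos v)\<^sup>2 + (sin v)\<^sup>2) - 2 * (cos u * cos v + sin u * sin v)"
    by (simp add: power2_eq_square algebra_simps)
  also have "\<dots> = 2 - 2 * cos (u - v)" by (simp add: cos_diff)
  also have "cos (u - v) = cos (2 * x)" unfolding x_def by (simp add: cos_abs_real)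
  also have "2 - 2 * cos (2 * x) = (2 * sin x)\<^sup>2" unfolding cos_double_sin by (simp add: power_mult_distrib)
  finally have eq: "(cmod (cis u - cis v))\<^sup>2 = (2 * sin x)\<^sup>2" .
  have "e \<le> 2 * sin x" using sin_ge_half[OF x(2,3)] x(1) by linarith
  then show "e\<^sup>2 \<le> (cmod (cis u - cis v))\<^sup>2" unfolding eq using assms(1) by (intro power_mono)
qed simp

lemma cos_ge_quadratic: "1 - x\<^sup>2 / 2 \<le> cos (x :: real)"
proof -
  have "\<bar>sin (x / 2)\<bar>\<^sup>2 \<le> \<bar>x / 2\<bar>\<^sup>2" by (intro power_mono abs_sin_x_le_abs_x) auto
  then show ?thesis using cos_double_sin[of "x / 2"] by (simp add: power_divide)
qed

text \<open>The angles lie in separated ranges, hence \<^const>\<open>vand\<close> is of order \<open>e\<^sup>3\<close> there.\<close>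

lemma weight_near:
  fixes e u v c \<epsilon> :: real
  assumes e: "0 < e" "e \<le> 1 / 10" and u: "e \<le> u" "u \<le> 2 * e" and v: "4 * e \<le> v" "v \<le> 5 * e"
    and c: "c = 4 + 2 * sqrt 2" and eps: "78 * e\<^sup>2 \<le> \<epsilon>" "\<epsilon> \<le> 1"
    and N: "N > 0" and Z: "cis u \<in> unity_roots N" "cis v \<in> unity_roots N"
  shows "weight m (cis u) (cis v) \<ge> 7 * e ^ 6 * (c - 2 * \<epsilon>) ^ m"
proof -
  \<comment> \<open>The third angle lies between \<open>- 7 * e\<close> and \<open>- 5 * e\<close>,
    so any two of the three differ by at least \<open>2 * e\<close>.\<close>
  define w where "w = - (u + v)"
  have w: "1 / (cis u * cis v) = cis w" unfolding w_def by (simp add: cis_mult divide_inverse)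
  have Zw: "cis w \<in> unity_roots N" unfolding w[symmetric] by (intro unity_roots_inverse unity_roots_mult Z)
  have 1: "cis u * cis v * cis w = 1" unfolding w_def by (simp add: cis_mult)
  define s where "s = Re (symb (cis u) (cis v) (cis w))"
  have "s = 2 + (2 * cos u + 2 * cos v + 2 * cos w)" unfolding s_def torus_point(3)[OF N Z Zw 1] by simp
  then have "8 - (u\<^sup>2 + v\<^sup>2 + w\<^sup>2) \<le> s"
    using cos_ge_quadratic[of u] cos_ge_quadratic[of v] cos_ge_quadratic[of w] by linarith
  \<comment> \<open>The constant 78 is 4 + 25 + 49.\<close>
  moreover have "u\<^sup>2 \<le> (2 * e)\<^sup>2" "v\<^sup>2 \<le> (5 * e)\<^sup>2" "(u + v)\<^sup>2 \<le> (7 * e)\<^sup>2"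
    using e u v by (intro power_mono; linarith)+
  moreover have "w\<^sup>2 = (u + v)\<^sup>2" unfolding w_def by (rule power2_minus)
  ultimately have s: "8 - \<epsilon> \<le> s" using eps by (simp add: power_mult_distrib)
  have c68: "6.8 \<le> c" "c\<^sup>2 = 8 * c - 8"
  proof -
    have "1.4 \<le> sqrt 2" by (rule real_le_rsqrt) (simp add: power2_eq_square)
    then show "6.8 \<le> c" unfolding c by simp
    have "sqrt 2 * sqrt 2 = (2::real)" by simp
    then show "c\<^sup>2 = 8 * c - 8" unfolding c by (simp add: power2_eq_square algebra_simps)
  qed
  have eps0: "0 \<le> \<epsilon>" using eps(1) by (meson order_trans zero_le_mult_iff zero_le_numeral zero_le_power2)
  \<comment> \<open>At \<open>s = 8\<close> the larger root of \<open>l^2 = s * l - s\<close> is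
    \<open>c\<close> and has slope about 1.03 in \<open>s\<close>; slope 2 leaves room for the
    curvature.\<close>
  define \<rho> where "\<rho> = c - 2 * \<epsilon>"
  have \<rho>: "4 \<le> \<rho>" unfolding \<rho>_def using c68 eps by simp
  have "(8 - \<epsilon>) * (\<rho> - 1) - \<rho>\<^sup>2 = (8 * c - 8 - c\<^sup>2) + \<epsilon> * (3 * c - 15 - 2 * \<epsilon>)"
    unfolding \<rho>_def by (simp add: power2_eq_square algebra_simps)
  also have "\<dots> \<ge> 0" unfolding c68(2) using c68(1) eps eps0 by simp
  finally have "\<rho>\<^sup>2 \<le> (8 - \<epsilon>) * (\<rho> - 1)" by simp
  also have "\<dots> \<le> s * (\<rho> - 1)" using s \<rho> by (intro mult_right_mono) auto
  finally have "\<rho> ^ m \<le> cheb (Suc m) s" using cheb_ge_power[of \<rho> s m] \<rho> s eps by simp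
  moreover have "e ^ 6 \<le> (cmod (vand (cis u) (cis v) (cis w)))\<^sup>2"
  proof -
    have "e * e * e \<le> cmod (vand (cis u) (cis v) (cis w))"
      unfolding vand_def norm_mult
      by (intro mult_mono cmod_cis_diff_ge) (use e u v in \<open>auto simp: w_def\<close>)
    then have "(e * e * e)\<^sup>2 \<le> (cmod (vand (cis u) (cis v) (cis w)))\<^sup>2"
      using e by (intro power_mono) auto
    then show ?thesis by (simp add: power2_eq_square numeral_eq_Suc mult.assoc)
  qed
  moreover have "7 \<le> s" using s eps by simp
  ultimately have "e ^ 6 * (7 * \<rho> ^ m) \<le> (cmod (vand (cis u) (cis v) (cis w)))\<^sup>2 * (s * cheb (Suc m) s)"
    using e \<rho> by (intro mult_mono) auto
  then show ?thesis unfolding weight_def w Let_def s_def \<rho>_def by (simp add: mult_ac)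
qed

text \<open>\<open>t\<close> fixes the radius of the neighbourhood of the maximum. \<open>k\<close>
  only refines the grid: \<open>N\<close> can be made as large as the degrees require while the
  bound, relative to the \<open>N^2\<close> grid points, stays the same.\<close>

lemma val_B_lower:
  fixes c \<epsilon> :: real
  assumes t: "t \<ge> 1" and k: "k \<ge> 1" and N: "N = 80 * t * k" and c: "c = 4 + 2 * sqrt 2"
    and eps: "1 / (real t)\<^sup>2 \<le> \<epsilon>" "\<epsilon> \<le> 1"
  shows "6 * Re (val_B N m 1 1) \<ge>
    (real N)\<^sup>2 * (7 / (6400 * 20 ^ 6 * real t ^ 8) * (c - 2 * \<epsilon>) ^ m - 256 * 5 ^ Suc m)"
proof -
  have N0: "N > 0" using t k N by simp
  let ?Z = "unity_roots N"
  let ?z = "\<lambda>i. cis (2 * pi * real i / real N)"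
  let ?I = "{k..<2 * k} \<times> {4 * k..<5 * k}"
  have bij: "bij_betw ?z {..<N} ?Z" unfolding unity_roots_def using bij_betw_roots_unity[OF N0] .
  have "1 * (5 * k) \<le> t * (80 * k)" using t by (intro mult_mono) auto
  then have kN: "5 * k \<le> N" unfolding N by (simp add: mult_ac)
  \<comment> \<open>With this unit the root of index \<open>i\<close> has angle
    \<open>e * i / k\<close>, so \<open>?I\<close> picks \<open>k * k\<close> points in the ranges
    of \<open>weight_near\<close>.\<close>
  define e where "e = pi / (40 * real t)"
  have e0: "0 < e" unfolding e_def using t by simp
  have e1: "e \<le> 1 / (10 * real t)" unfolding e_def using pi_less_4 t by (simp add: divide_simps)
  have e2: "1 / (20 * real t) \<le> e" unfolding e_def using pi_ge_two t by (simp add: divide_simps)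
  have e3: "e \<le> 1 / 10"
  proof -
    have "1 / (10 * real t) \<le> 1 / 10" using t by (simp add: divide_simps)
    then show ?thesis using e1 by linarith
  qed
  have ek': "real p * e = 2 * pi * (real p * real k) / real N" for p unfolding e_def N using k t by simp
  have ang: "real p * e \<le> 2 * pi * real i / real N" if "p * k \<le> i" for p i
  proof -
    have "real p * real k \<le> real i" using that by (metis of_nat_le_iff of_nat_mult)
    then have "2 * pi * (real p * real k) / real N \<le> 2 * pi * real i / real N"
      by (intro divide_right_mono mult_left_mono) auto
    then show ?thesis unfolding ek' .
  qed
  have ang': "2 * pi * real i / real N \<le> real p * e" if "i \<le> p * k" for p i
  proof -
    have "real i \<le> real p * real k" using that by (metis of_nat_le_iff of_nat_mult)
    then have "2 * pi * real i / real N \<le> 2 * pi * (real p * real k) / real N"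
      by (intro divide_right_mono mult_left_mono) auto
    then show ?thesis unfolding ek' .
  qed
  have "78 * e\<^sup>2 \<le> 78 * (1 / (10 * real t))\<^sup>2" using e0 e1 by (intro mult_left_mono power_mono) auto
  also have "\<dots> \<le> 1 / (real t)\<^sup>2" using t by (simp add: power_mult_distrib power_divide divide_simps)
  finally have ee: "78 * e\<^sup>2 \<le> \<epsilon>" using eps by linarith
  let ?L = "7 * e ^ 6 * (c - 2 * \<epsilon>) ^ m"
  let ?M = "256 * (5::real) ^ Suc m"
  let ?Q = "(\<lambda>(i, j). (?z i, ?z j)) ` ?I"
  have inj: "inj_on (\<lambda>(i, j). (?z i, ?z j)) ?I"
  proof (rule inj_onI, clarify)
    fix i j i' j' assume *: "i \<in> {k..<2 * k}" "j \<in> {4 * k..<5 * k}" "i' \<in> {k..<2 * k}" "j' \<in> {4 * k..<5 * k}"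
      and eq: "?z i = ?z i'" "?z j = ?z j'"
    have "inj_on ?z {..<N}" using bij unfolding bij_betw_def by blast
    from inj_onD[OF this eq(1)] inj_onD[OF this eq(2)] show "i = i' \<and> j = j'" using * kN by simp
  qed
  have Zi: "?z i \<in> ?Z" if "i < N" for i using bij that unfolding bij_betw_def by blast
  have QZ: "?Q \<subseteq> ?Z \<times> ?Z" using Zi kN by auto
  have fin: "finite (?Z \<times> ?Z)" using finite_unity_roots[OF N0] by simp
  have near: "weight m (?z i) (?z j) \<ge> ?L" if "(i, j) \<in> ?I" for i j
    using that kN ang[of 1 i] ang'[of i 2] ang[of 4 j] ang'[of j 5]
    by (intro weight_near[OF e0 e3 _ _ _ _ c ee eps(2) N0] Zi) auto
  have "(\<Sum>(a, b)\<in>?Q. weight m a b) = (\<Sum>(i, j)\<in>?I. weight m (?z i) (?z j))"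
    by (subst sum.reindex[OF inj]) (simp add: case_prod_unfold)
  also have "\<dots> \<ge> (\<Sum>(i, j)\<in>?I. ?L)" using near by (intro sum_mono) auto
  also have "(\<Sum>(i, j)\<in>?I. ?L) = (real k)\<^sup>2 * ?L" by (simp add: power2_eq_square case_prod_unfold)
  finally have Q: "(real k)\<^sup>2 * ?L \<le> (\<Sum>(a, b)\<in>?Q. weight m a b)" .
  have "(\<Sum>(a, b)\<in>?Z \<times> ?Z - ?Q. - ?M) \<le> (\<Sum>(a, b)\<in>?Z \<times> ?Z - ?Q. weight m a b)"
    using weight_ge[OF N0] by (intro sum_mono) auto
  moreover have "(\<Sum>(a, b)\<in>?Z \<times> ?Z - ?Q. - ?M) \<ge> - ((real N)\<^sup>2 * ?M)"
  proof -
    have "card (?Z \<times> ?Z - ?Q) \<le> card (?Z \<times> ?Z)" using fin by (intro card_mono) auto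
    then have "real (card (?Z \<times> ?Z - ?Q)) \<le> (real N)\<^sup>2"
      by (simp add: card_cartesian_product card_unity_roots[OF N0] power2_eq_square flip: of_nat_mult)
    then have "real (card (?Z \<times> ?Z - ?Q)) * ?M \<le> (real N)\<^sup>2 * ?M" by (intro mult_right_mono) auto
    then show ?thesis by (simp add: case_prod_unfold)
  qed
  ultimately have "(real k)\<^sup>2 * ?L - (real N)\<^sup>2 * ?M \<le> 6 * Re (val_B N m 1 1)"
    unfolding val_B_weight[OF N0] sum.subset_diff[OF QZ fin] using Q by linarith
  moreover have "(real N)\<^sup>2 * (7 / (6400 * 20 ^ 6 * real t ^ 8) * (c - 2 * \<epsilon>) ^ m) \<le> (real k)\<^sup>2 * ?L"
  proof -
    have c0: "0 \<le> c - 2 * \<epsilon>" unfolding c using eps real_sqrt_ge_zero[of 2] by linarith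
    have "(1 / (20 * real t)) ^ 6 \<le> e ^ 6" using e2 t by (intro power_mono) auto
    then have "(real k)\<^sup>2 * (7 * (1 / (20 * real t)) ^ 6 * (c - 2 * \<epsilon>) ^ m) \<le> (real k)\<^sup>2 * ?L"
      using c0 by (intro mult_left_mono mult_right_mono) auto
    moreover have "(real k)\<^sup>2 * (7 * (1 / (20 * real t)) ^ 6 * (c - 2 * \<epsilon>) ^ m) =
        (real N)\<^sup>2 * (7 / (6400 * 20 ^ 6 * real t ^ 8) * (c - 2 * \<epsilon>) ^ m)"
      unfolding N using t by (simp add: power_mult_distrib power_divide divide_simps power2_eq_square numeral_eq_Suc)
    ultimately show ?thesis by simp
  qed
  ultimately show ?thesis by (simp only: right_diff_distrib)
qed


section \<open>Choice of the parameters and the final constant\<close>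

lemma power_4_times_power_tendsto_0:
  fixes x :: real
  assumes "0 \<le> x" "x < 1"
  shows "(\<lambda>n. real n ^ 4 * x ^ n) \<longlonglongrightarrow> 0"
proof -
  define s where "s = sqrt (sqrt x)"
  have s4: "s ^ 4 = x" unfolding s_def using assms(1) power_mult[of "sqrt (sqrt x)" 2 2] by simp
  have "norm s < 1" unfolding s_def using assms by simp
  from tendsto_power[OF powser_times_n_limit_0[OF this], of 4]
  have "(\<lambda>n. (real n * s ^ n) ^ 4) \<longlonglongrightarrow> 0" by simp
  moreover have "(real n * s ^ n) ^ 4 = real n ^ 4 * x ^ n" for n
    unfolding s4[symmetric] by (simp add: power_mult_distrib mult.commute flip: power_mult)
  ultimately show ?thesis by simp
qed

lemma tree_count_pos: "p \<ge> 1 \<Longrightarrow> q \<ge> 1 \<Longrightarrow> tree_count m p q l r \<ge> 1"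
proof (induction m arbitrary: p q l r)
  case (Suc m)
  have "1 \<le> tree_count m (p + of_bool r) 1 (r \<and> 1 = q) True" using Suc by simp
  also have "\<dots> \<le> (\<Sum>j\<in>{1..q}. tree_count m (p + of_bool r) j (r \<and> j = q) True)"
    using Suc.prems by (intro member_le_sum[of 1 _ "\<lambda>j. tree_count m (p + of_bool r) j (r \<and> j = q) True"]) auto
  finally show ?case by simp
qed simp

text \<open>The constants: 24 is 6 from the symmetrisation times 4 from
  \<open>val_le_tree_count\<close>, \<open>512 * c\<close> is 256 from \<open>t ^ 8\<close> times
  the loss \<open>2 * c\<close> of the Bernoulli estimate, and 11 rounds up 256 / 24.\<close>

lemma tree_count_lower:
  fixes c :: real
  assumes c: "c = 4 + 2 * sqrt 2" and n: "n \<ge> 2"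
  shows "7 / (24 * 6400 * 20 ^ 6 * 512 * c) * (c ^ n / real n ^ 4) - 11 * 5 ^ n
    \<le> real (tree_count (n - 1) 1 1 True True)"
proof -
  \<comment> \<open>A radius of order n^(-1/2) lowers the growth rate by \<open>2 / n\<close>, which
    costs only a constant factor over n steps, while \<open>t ^ 8\<close> is of order n^4.\<close>
  define t where "t = nat \<lceil>sqrt (real n)\<rceil>"
  have sn: "1 \<le> sqrt (real n)" using n by simp
  have t1: "sqrt (real n) \<le> real t" unfolding t_def by linarith
  have t2: "real t \<le> 2 * sqrt (real n)" unfolding t_def using sn by linarith
  have tn: "t \<ge> 1" using t1 sn by linarith
  have "sqrt (real n) ^ 2 \<le> real t ^ 2" using t1 by (intro power_mono) auto
  then have eps: "1 / (real t)\<^sup>2 \<le> 1 / real n" using n tn by (intro divide_left_mono) auto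
  have "real t ^ 8 \<le> (2 * sqrt (real n)) ^ 8" using t2 by (intro power_mono) auto
  also have "\<dots> = 256 * (sqrt (real n) ^ 2) ^ 4"
    using power_mult[of "sqrt (real n)" 2 4] by (simp add: power_mult_distrib)
  finally have t8: "real t ^ 8 \<le> 256 * real n ^ 4" by simp
  define k where "k = n + 10"
  define N where "N = 80 * t * k"
  obtain m where m: "n = Suc (Suc m)" using n that[of "n - 2"] by simp
  have "1 * (80 * k) \<le> t * (80 * k)" using tn by (intro mult_mono) auto
  then have "80 * k \<le> N" unfolding N_def by (simp add: mult_ac)
  then have Nk: "1 + m + 4 < N" unfolding k_def m by simp
  then have N0: "0 < (real N)\<^sup>2" by simp
  have c6: "6 \<le> c" unfolding c using real_le_rsqrt[of 1 2] by simp
  let ?e = "1 / real n"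
  have "(real N)\<^sup>2 * (7 / (6400 * 20 ^ 6 * real t ^ 8) * (c - 2 * ?e) ^ Suc m - 256 * 5 ^ Suc (Suc m))
      \<le> 6 * Re (val_B N (Suc m) 1 1)"
    using n by (intro val_B_lower[OF tn _ N_def c eps]) (auto simp: k_def)
  also have "\<dots> \<le> 6 * (4 * real (N * N) * real (tree_count (Suc m) 1 1 True True))"
    using val_le_tree_count[of 1 1 m N] Nk by (intro mult_left_mono) auto
  also have "\<dots> = (real N)\<^sup>2 * (24 * real (tree_count (Suc m) 1 1 True True))"
    by (simp add: power2_eq_square)
  finally have 1: "7 / (6400 * 20 ^ 6 * real t ^ 8) * (c - 2 * ?e) ^ Suc m - 256 * 5 ^ Suc (Suc m)
      \<le> 24 * real (tree_count (Suc m) 1 1 True True)"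
    using N0 by (simp only: mult_le_cancel_left_pos)
  have "c ^ n / (2 * c) \<le> (c - 2 * ?e) ^ Suc m"
  proof -
    define x where "x = - (2 / (c * real n))"
    have cn: "12 \<le> c * real n" using c6 n mult_mono[of 6 c 2 "real n"] by simp
    have x1: "- 1 \<le> x" unfolding x_def using cn by simp
    have "real (Suc m) * (2 / (c * real n)) \<le> real n * (2 / (c * real n))"
      using c6 m by (intro mult_right_mono) auto
    also have "\<dots> = 2 / c" using n by simp
    also have "\<dots> \<le> 1 / 2" using c6 by simp
    finally have "1 / 2 \<le> 1 + real (Suc m) * x" unfolding x_def by simp
    also have "\<dots> \<le> (1 + x) ^ Suc m" by (rule Bernoulli_inequality[OF x1])
    finally have "c ^ Suc m * (1 / 2) \<le> c ^ Suc m * (1 + x) ^ Suc m" using c6 by (intro mult_left_mono) auto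
    also have "\<dots> = (c - 2 * ?e) ^ Suc m"
    proof -
      have "c * (1 + x) = c - 2 * ?e" unfolding x_def using c6 n by (simp add: field_simps)
      then show ?thesis by (metis power_mult_distrib)
    qed
    also have "c ^ Suc m * (1 / 2) = c ^ n / (2 * c)" unfolding m using c6 by simp
    finally show ?thesis .
  qed
  moreover have "7 / (6400 * 20 ^ 6 * (256 * real n ^ 4)) \<le> 7 / (6400 * 20 ^ 6 * real t ^ 8)"
    using t8 tn n by (intro divide_left_mono mult_left_mono mult_pos_pos) auto
  ultimately have "7 / (6400 * 20 ^ 6 * (256 * real n ^ 4)) * (c ^ n / (2 * c))
      \<le> 7 / (6400 * 20 ^ 6 * real t ^ 8) * (c - 2 * ?e) ^ Suc m"
    using c6 by (intro mult_mono) auto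
  also have "7 / (6400 * 20 ^ 6 * (256 * real n ^ 4)) * (c ^ n / (2 * c))
      = 24 * (7 / (24 * 6400 * 20 ^ 6 * 512 * c) * (c ^ n / real n ^ 4))"
    using c6 by simp
  finally have "24 * (7 / (24 * 6400 * 20 ^ 6 * 512 * c) * (c ^ n / real n ^ 4)) - 256 * 5 ^ n
      \<le> 24 * real (tree_count (n - 1) 1 1 True True)"
    using 1 unfolding m by simp
  moreover have "0 \<le> (5::real) ^ n" by simp
  ultimately show ?thesis by linarith
qed

lemma tree_count_asymptotic:
  fixes c :: real
  assumes c: "c = 4 + 2 * sqrt 2"
  shows "\<exists>K>0. \<forall>n\<ge>1. K * (c ^ n / real n ^ 4) \<le> real (tree_count (n - 1) 1 1 True True)"
proof -
  define K where "K = 7 / (24 * 6400 * 20 ^ 6 * 512 * c)"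
  have c6: "6 \<le> c" unfolding c using real_le_rsqrt[of 1 2] by simp
  have K: "K > 0" unfolding K_def using c6 by simp
  have "eventually (\<lambda>n. real n ^ 4 * (5 / c) ^ n < K / 22) sequentially"
    using order_tendstoD(2)[OF power_4_times_power_tendsto_0[of "5 / c"], of "K / 22"] K c6 by simp
  then obtain M where M: "\<And>n. n \<ge> M \<Longrightarrow> real n ^ 4 * (5 / c) ^ n < K / 22"
    unfolding eventually_sequentially by blast
  \<comment> \<open>The first entry keeps half of \<open>K\<close> after absorbing the error
    \<open>11 * 5 ^ n\<close>; the second makes the bound at most 1 for the finitely many small
    \<open>n\<close>.\<close>
  define K' where "K' = min (K / 2) (1 / c ^ (M + 2))"
  have "K' * (c ^ n / real n ^ 4) \<le> real (tree_count (n - 1) 1 1 True True)" if n: "n \<ge> 1" for n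
  proof (cases "n \<ge> M + 2")
    case True
    have "11 * 5 ^ n \<le> (K / 2) * (c ^ n / real n ^ 4)"
      using M[of n] True n c6 by (simp add: power_divide field_simps)
    moreover have "K' * (c ^ n / real n ^ 4) \<le> (K / 2) * (c ^ n / real n ^ 4)"
      unfolding K'_def using c6 by (intro mult_right_mono) auto
    ultimately show ?thesis using tree_count_lower[OF c, of n] True unfolding K_def by simp
  next
    case False
    have "c ^ n / real n ^ 4 \<le> c ^ n / 1" using c6 n by (intro divide_left_mono) auto
    also have "\<dots> = c ^ n" by simp
    also have "\<dots> \<le> c ^ (M + 2)" using False c6 by (intro power_increasing) auto
    finally have "K' * (c ^ n / real n ^ 4) \<le> (1 / c ^ (M + 2)) * c ^ (M + 2)"
      using c6 unfolding K'_def by (intro mult_mono) auto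
    also have "\<dots> = 1" using c6 by simp
    also have "1 \<le> real (tree_count (n - 1) 1 1 True True)" using tree_count_pos[of 1 1 "n - 1"] by simp
    finally show ?thesis .
  qed
  moreover have "K' > 0" unfolding K'_def using K c6 by simp
  ultimately show ?thesis by blast
qed

theorem theorem31:
  fixes c :: real
  assumes "c = 4 + 2 * sqrt 2"
  shows "c \<ge> 6.828 \<and>
    (\<exists>K::real. K > 0 \<and>
      (\<forall>n::nat. n \<ge> 1 \<longrightarrow>
        (\<forall>R. complete_representations n R \<longrightarrow>
          real (card R) \<ge> K * (fact n * (c ^ n / real n ^ 4)))))"
proof (rule conjI)
  have "1.414 \<le> sqrt 2" by (rule real_le_rsqrt) (simp add: power2_eq_square)
  then show "c \<ge> 6.828" unfolding assms by simp
  obtain K where K: "K > 0"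
    "\<And>n. n \<ge> 1 \<Longrightarrow> K * (c ^ n / real n ^ 4) \<le> real (tree_count (n - 1) 1 1 True True)"
    using tree_count_asymptotic[OF assms] by blast
  have "K * (fact n * (c ^ n / real n ^ 4)) \<le> real (card R)"
    if n: "n \<ge> 1" and R: "complete_representations n R" for n R
  proof -
    have "tree_count (n - 1) 1 1 True True \<le> card (rigid_orders n)"
      using tree_count_le_card_rigid_orders[of "n - 1"] n by simp
    then have "K * (c ^ n / real n ^ 4) \<le> real (card (rigid_orders n))" using K(2)[OF n] by linarith
    then have "fact n * (K * (c ^ n / real n ^ 4)) \<le> fact n * real (card (rigid_orders n))"
      by (intro mult_left_mono) auto
    also have "\<dots> \<le> real (card R)"
      using card_complete_representations[OF R] by (metis of_nat_fact of_nat_le_iff of_nat_mult)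
    finally show ?thesis by (simp add: mult_ac)
  qed
  then show "\<exists>K::real. K > 0 \<and> (\<forall>n::nat. n \<ge> 1 \<longrightarrow> (\<forall>R. complete_representations n R \<longrightarrow>
      real (card R) \<ge> K * (fact n * (c ^ n / real n ^ 4))))"
    using K(1) by blast
qed

end
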